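(* Let $\mathcal A$ be an almost disjoint family on $\omega$ which remains MAD and fin-intersecting after adding one Cohen real. Then, for every cardinal $\kappa\geq 1$, $\mathcal A$ also remains MAD and fin-intersecting after adding $\kappa$ Cohen reals with finite supports.
   Context: An almost disjoint family on $\omega$ is an infinite set $\mathcal A$ of infinite subsets of $\omega$ such that $a\cap b$ is finite for all distinct $a,b\in\mathcal A$; it is MAD if it is not properly contained in any other almost disjoint family on $\omega$. A fin sequence is a function $C:\omega\to[\omega]^{<\omega}\setminus\{\emptyset\}$ with $C(n)\cap C(m)=\emptyset$ whenever $n\neq m$. A collection of sets is centered if every finite nonempty subcollection has infinite intersection. An almost disjoint family $\mathcal A$ is fin-intersecting if for every fin sequence $C$ there exists an infinite $I\subseteq\omega$ such that $\{\{n\in I: a\cap C(n)\neq\emptyset\}: a\in\mathcal A\}\setminus[I]^{<\omega}$ is centered, where $[I]^{<\omega}$ is the set of finite subsets of $I$. Adding $\kappa$ Cohen reals with finite supports means forcing with the poset of finite partial functions from $\kappa\times\omega$ to $2$ ordered by reverse inclusion (for $\kappa=1$: adding one Cohen real). "$\mathcal A$ remains MAD and fin-intersecting after forcing with $\mathbb P$" means $\Vdash_{\mathbb P}$ "$\check{\mathcal A}$ is MAD and fin-intersecting". *)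

theory Defs
  imports Main
begin

section \<open>Almost disjoint families in the ground model\<close>

definition almost_disjoint_family :: "nat set set \<Rightarrow> bool" where
  "almost_disjoint_family A \<longleftrightarrow>
     infinite A \<and> (\<forall>a\<in>A. infinite a) \<and> (\<forall>a\<in>A. \<forall>b\<in>A. a \<noteq> b \<longrightarrow> finite (a \<inter> b))"


section \<open>Names and the forcing relation\<close>

text \<open>
  A name for a subset of \<open>\<omega>\<close> is a set of pairs \<open>(n, p)\<close>, where \<open>n\<close> stands for its check name; a
  name for a family of subsets of \<open>\<omega>\<close> is a set of pairs of a name for a subset of \<open>\<omega>\<close> and a
  condition; a name for a sequence \<open>\<omega> \<rightarrow> \<P>(\<omega>)\<close> is given by the sequence of names of its values.
  Over any forcing notion, every name for an object of one of these kinds is forced to be equal to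
  one of this form, so quantifying over these names is the same as quantifying over all names.
\<close>

type_synonym 'p real_name = "(nat \<times> 'p) set"
type_synonym 'p family_name = "('p real_name \<times> 'p) set"

text \<open>A sentence of the forcing language is identified with the set of conditions forcing it.\<close>

type_synonym 'p sentence = "'p \<Rightarrow> bool"

locale forcing_notion =
  fixes P :: "'p set"
    and le :: "'p \<Rightarrow> 'p \<Rightarrow> bool"  (infix "\<preceq>" 50)
    and one :: 'p  ("\<one>")
  assumes le_refl: "p \<in> P \<Longrightarrow> p \<preceq> p"
    and le_trans: "p \<in> P \<Longrightarrow> q \<in> P \<Longrightarrow> r \<in> P \<Longrightarrow> p \<preceq> q \<Longrightarrow> q \<preceq> r \<Longrightarrow> p \<preceq> r"
    and one_in: "\<one> \<in> P"
    and le_one: "p \<in> P \<Longrightarrow> p \<preceq> \<one>"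
begin

definition forced :: "'p sentence \<Rightarrow> bool"  ("\<tturnstile> _" [20] 20) where
  "(\<tturnstile> \<phi>) \<longleftrightarrow> (\<forall>p\<in>P. \<phi> p)"

definition dense_below :: "'p set \<Rightarrow> 'p \<Rightarrow> bool" where
  "dense_below D p \<longleftrightarrow> (\<forall>q\<in>P. q \<preceq> p \<longrightarrow> (\<exists>r\<in>P. r \<preceq> q \<and> r \<in> D))"

definition Neg :: "'p sentence \<Rightarrow> 'p sentence"  ("\<^bold>\<not> _" [40] 40) where
  "(\<^bold>\<not> \<phi>) = (\<lambda>p. \<forall>q\<in>P. q \<preceq> p \<longrightarrow> \<not> \<phi> q)"

definition Conj :: "'p sentence \<Rightarrow> 'p sentence \<Rightarrow> 'p sentence"  (infixr "\<^bold>\<and>" 35) where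
  "(\<phi> \<^bold>\<and> \<psi>) = (\<lambda>p. \<phi> p \<and> \<psi> p)"

definition Impl :: "'p sentence \<Rightarrow> 'p sentence \<Rightarrow> 'p sentence"  (infixr "\<^bold>\<longrightarrow>" 25) where
  "(\<phi> \<^bold>\<longrightarrow> \<psi>) = (\<^bold>\<not> (\<phi> \<^bold>\<and> \<^bold>\<not> \<psi>))"

definition Iff :: "'p sentence \<Rightarrow> 'p sentence \<Rightarrow> 'p sentence"  (infixr "\<^bold>\<longleftrightarrow>" 25) where
  "(\<phi> \<^bold>\<longleftrightarrow> \<psi>) = ((\<phi> \<^bold>\<longrightarrow> \<psi>) \<^bold>\<and> (\<psi> \<^bold>\<longrightarrow> \<phi>))"

definition Forall :: "'n set \<Rightarrow> ('n \<Rightarrow> 'p sentence) \<Rightarrow> 'p sentence" where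
  "Forall N \<phi> = (\<lambda>p. \<forall>x\<in>N. \<phi> x p)"

definition Exists :: "'n set \<Rightarrow> ('n \<Rightarrow> 'p sentence) \<Rightarrow> 'p sentence" where
  "Exists N \<phi> = (\<^bold>\<not> Forall N (\<lambda>x. \<^bold>\<not> \<phi> x))"

definition real_names :: "'p real_name set" where
  "real_names = Pow (UNIV \<times> P)"

definition family_names :: "'p family_name set" where
  "family_names = Pow (real_names \<times> P)"

definition sequence_names :: "(nat \<Rightarrow> 'p real_name) set" where
  "sequence_names = {s. \<forall>n. s n \<in> real_names}"

text \<open>
  A quantifier over the elements of a ground model set is a quantifier over their check names.
  This covers the quantifiers over \<open>\<omega>\<close> and \<open>[\<omega>]\<^sup><\<^sup>\<omega>\<close>, which are the same in the extension.
\<close>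

abbreviation all_nat  (binder "\<^bold>\<forall>\<^sub>\<omega>" 10) where "all_nat \<phi> \<equiv> Forall (UNIV :: nat set) \<phi>"
abbreviation ex_nat  (binder "\<^bold>\<exists>\<^sub>\<omega>" 10) where "ex_nat \<phi> \<equiv> Exists (UNIV :: nat set) \<phi>"
abbreviation ex_fin  (binder "\<^bold>\<exists>\<^sub>f\<^sub>i\<^sub>n" 10) where "ex_fin \<phi> \<equiv> Exists {F :: nat set. finite F} \<phi>"
abbreviation all_real  (binder "\<^bold>\<forall>\<^sub>r" 10) where "all_real \<phi> \<equiv> Forall real_names \<phi>"
abbreviation ex_real  (binder "\<^bold>\<exists>\<^sub>r" 10) where "ex_real \<phi> \<equiv> Exists real_names \<phi>"
abbreviation all_fam  (binder "\<^bold>\<forall>\<^sub>F" 10) where "all_fam \<phi> \<equiv> Forall family_names \<phi>"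
abbreviation ex_fam  (binder "\<^bold>\<exists>\<^sub>F" 10) where "ex_fam \<phi> \<equiv> Exists family_names \<phi>"
abbreviation all_seq  (binder "\<^bold>\<forall>\<^sub>s" 10) where "all_seq \<phi> \<equiv> Forall sequence_names \<phi>"
abbreviation ex_seq  (binder "\<^bold>\<exists>\<^sub>s" 10) where "ex_seq \<phi> \<equiv> Exists sequence_names \<phi>"

definition check :: "nat set \<Rightarrow> 'p real_name" where
  "check a = a \<times> {\<one>}"

definition check_family :: "nat set set \<Rightarrow> 'p family_name" where
  "check_family A = check ` A \<times> {\<one>}"

text \<open>
  Both membership relations follow the usual clause: \<open>p \<tturnstile> \<sigma> \<in> \<tau>\<close> iff the set
  \<open>{r. \<exists>(\<pi>, q) \<in> \<tau>. r \<preceq> q \<and> r \<tturnstile> \<sigma> = \<pi>}\<close> is dense below \<open>p\<close>. For check names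
  of natural numbers, \<open>r \<tturnstile> n = m\<close> holds iff \<open>n = m\<close>.
\<close>

definition Mem :: "nat \<Rightarrow> 'p real_name \<Rightarrow> 'p sentence"  (infix "\<^bold>\<in>" 50) where
  "(n \<^bold>\<in> \<sigma>) = dense_below {r. \<exists>q. (n, q) \<in> \<sigma> \<and> r \<preceq> q}"

definition Eq :: "'p real_name \<Rightarrow> 'p real_name \<Rightarrow> 'p sentence"  (infix "\<^bold>=" 50) where
  "(\<sigma> \<^bold>= \<tau>) = (\<^bold>\<forall>\<^sub>\<omega>n. n \<^bold>\<in> \<sigma> \<^bold>\<longleftrightarrow> n \<^bold>\<in> \<tau>)"

definition MemF :: "'p real_name \<Rightarrow> 'p family_name \<Rightarrow> 'p sentence"  (infix "\<^bold>\<in>\<^sub>F" 50) where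
  "(\<sigma> \<^bold>\<in>\<^sub>F \<T>) = dense_below {r. \<exists>\<pi> q. (\<pi>, q) \<in> \<T> \<and> r \<preceq> q \<and> (\<sigma> \<^bold>= \<pi>) r}"

definition SubF :: "'p family_name \<Rightarrow> 'p family_name \<Rightarrow> 'p sentence"  (infix "\<^bold>\<subseteq>\<^sub>F" 50) where
  "(\<S> \<^bold>\<subseteq>\<^sub>F \<T>) = (\<^bold>\<forall>\<^sub>rx. x \<^bold>\<in>\<^sub>F \<S> \<^bold>\<longrightarrow> x \<^bold>\<in>\<^sub>F \<T>)"

definition EqF :: "'p family_name \<Rightarrow> 'p family_name \<Rightarrow> 'p sentence"  (infix "\<^bold>=\<^sub>F" 50) where
  "(\<S> \<^bold>=\<^sub>F \<T>) = (\<^bold>\<forall>\<^sub>rx. x \<^bold>\<in>\<^sub>F \<S> \<^bold>\<longleftrightarrow> x \<^bold>\<in>\<^sub>F \<T>)"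


section \<open>The combinatorial notions in the forcing language\<close>

text \<open>Definable subsets \<open>{n \<in> \<omega>. \<phi> n}\<close> of the extension are represented by \<open>\<phi>\<close>.\<close>

definition Fin :: "(nat \<Rightarrow> 'p sentence) \<Rightarrow> 'p sentence" where
  "Fin \<phi> = (\<^bold>\<exists>\<^sub>f\<^sub>i\<^sub>nF. \<^bold>\<forall>\<^sub>\<omega>n. \<phi> n \<^bold>\<longleftrightarrow> n \<^bold>\<in> check F)"

definition Infin :: "(nat \<Rightarrow> 'p sentence) \<Rightarrow> 'p sentence" where
  "Infin \<phi> = (\<^bold>\<not> Fin \<phi>)"

definition FinF :: "'p family_name \<Rightarrow> 'p sentence" where
  "FinF \<T> = (\<^bold>\<exists>\<^sub>\<omega>n. \<^bold>\<exists>\<^sub>ss. \<^bold>\<forall>\<^sub>rx. x \<^bold>\<in>\<^sub>F \<T> \<^bold>\<longleftrightarrow> Exists {..<n} (\<lambda>i. x \<^bold>= s i))"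

definition AD_family :: "'p family_name \<Rightarrow> 'p sentence" where
  "AD_family \<A> =
     ((\<^bold>\<not> FinF \<A>) \<^bold>\<and>
      (\<^bold>\<forall>\<^sub>ra. a \<^bold>\<in>\<^sub>F \<A> \<^bold>\<longrightarrow> Infin (\<lambda>n. n \<^bold>\<in> a)) \<^bold>\<and>
      (\<^bold>\<forall>\<^sub>ra. \<^bold>\<forall>\<^sub>rb. a \<^bold>\<in>\<^sub>F \<A> \<^bold>\<and> b \<^bold>\<in>\<^sub>F \<A> \<^bold>\<and> (\<^bold>\<not> a \<^bold>= b) \<^bold>\<longrightarrow> Fin (\<lambda>n. n \<^bold>\<in> a \<^bold>\<and> n \<^bold>\<in> b)))"

definition MAD :: "'p family_name \<Rightarrow> 'p sentence" where
  "MAD \<A> =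
     (AD_family \<A> \<^bold>\<and> (\<^bold>\<not> (\<^bold>\<exists>\<^sub>F\<B>. AD_family \<B> \<^bold>\<and> \<A> \<^bold>\<subseteq>\<^sub>F \<B> \<^bold>\<and> (\<^bold>\<not> \<A> \<^bold>=\<^sub>F \<B>))))"

definition fin_sequence :: "(nat \<Rightarrow> 'p real_name) \<Rightarrow> 'p sentence" where
  "fin_sequence C =
     ((\<^bold>\<forall>\<^sub>\<omega>n. Fin (\<lambda>k. k \<^bold>\<in> C n) \<^bold>\<and> (\<^bold>\<exists>\<^sub>\<omega>k. k \<^bold>\<in> C n)) \<^bold>\<and>
      (\<^bold>\<forall>\<^sub>\<omega>n. Forall {m. m \<noteq> n} (\<lambda>m. \<^bold>\<not> (\<^bold>\<exists>\<^sub>\<omega>k. k \<^bold>\<in> C n \<^bold>\<and> k \<^bold>\<in> C m))))"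

text \<open>The collection is given by a formula, i.e. it is \<open>{x \<in> \<P>(\<omega>). \<Phi> x}\<close>.\<close>

definition centered :: "('p real_name \<Rightarrow> 'p sentence) \<Rightarrow> 'p sentence" where
  "centered \<Phi> =
     (\<^bold>\<forall>\<^sub>F\<F>. (\<^bold>\<forall>\<^sub>rx. x \<^bold>\<in>\<^sub>F \<F> \<^bold>\<longrightarrow> \<Phi> x) \<^bold>\<and> FinF \<F> \<^bold>\<and> (\<^bold>\<exists>\<^sub>rx. x \<^bold>\<in>\<^sub>F \<F>) \<^bold>\<longrightarrow>
        Infin (\<lambda>k. \<^bold>\<forall>\<^sub>rx. x \<^bold>\<in>\<^sub>F \<F> \<^bold>\<longrightarrow> k \<^bold>\<in> x))"

text \<open>The collection of the traces \<open>{n \<in> I. a \<inter> C n \<noteq> \<emptyset>}\<close> with \<open>a \<in> \<A>\<close>, minus \<open>[I]\<^sup><\<^sup>\<omega>\<close>.\<close>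

definition traces ::
  "'p family_name \<Rightarrow> (nat \<Rightarrow> 'p real_name) \<Rightarrow> 'p real_name \<Rightarrow> 'p real_name \<Rightarrow> 'p sentence" where
  "traces \<A> C I x =
     ((\<^bold>\<exists>\<^sub>ra. a \<^bold>\<in>\<^sub>F \<A> \<^bold>\<and> (\<^bold>\<forall>\<^sub>\<omega>n. n \<^bold>\<in> x \<^bold>\<longleftrightarrow> n \<^bold>\<in> I \<^bold>\<and> (\<^bold>\<exists>\<^sub>\<omega>k. k \<^bold>\<in> a \<^bold>\<and> k \<^bold>\<in> C n))) \<^bold>\<and>
      (\<^bold>\<not> ((\<^bold>\<forall>\<^sub>\<omega>n. n \<^bold>\<in> x \<^bold>\<longrightarrow> n \<^bold>\<in> I) \<^bold>\<and> Fin (\<lambda>n. n \<^bold>\<in> x))))"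

definition fin_intersecting :: "'p family_name \<Rightarrow> 'p sentence" where
  "fin_intersecting \<A> =
     (AD_family \<A> \<^bold>\<and>
      (\<^bold>\<forall>\<^sub>sC. fin_sequence C \<^bold>\<longrightarrow> (\<^bold>\<exists>\<^sub>rI. Infin (\<lambda>n. n \<^bold>\<in> I) \<^bold>\<and> centered (traces \<A> C I))))"

definition remains_MAD_and_fin_intersecting :: "nat set set \<Rightarrow> bool" where
  "remains_MAD_and_fin_intersecting A \<longleftrightarrow>
     (\<tturnstile> MAD (check_family A) \<^bold>\<and> fin_intersecting (check_family A))"

end


section \<open>Adding Cohen reals\<close>

definition Cohen :: "'k set \<Rightarrow> ('k \<times> nat \<rightharpoonup> bool) set" where
  "Cohen K = {p. finite (dom p) \<and> dom p \<subseteq> K \<times> UNIV}"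

definition extends :: "('a \<rightharpoonup> 'b) \<Rightarrow> ('a \<rightharpoonup> 'b) \<Rightarrow> bool" where
  "extends p q \<longleftrightarrow> q \<subseteq>\<^sub>m p"

lemma forcing_notion_Cohen: "forcing_notion (Cohen K) extends Map.empty"
  by unfold_locales (auto simp: Cohen_def extends_def intro: map_le_trans)

definition remains_MAD_and_fin_intersecting_after_Cohen :: "'k set \<Rightarrow> nat set set \<Rightarrow> bool" where
  "remains_MAD_and_fin_intersecting_after_Cohen K A \<longleftrightarrow>
     forcing_notion.remains_MAD_and_fin_intersecting (Cohen K) extends Map.empty A"

end

theory Submission
  imports Defs "HOL-Library.Countable_Set"
begin

text \<open>
  The theorem is true because each real of the extension by \<open>\<kappa>\<close> Cohen reals already lies in an
  extension by countably many of them, and adding countably many Cohen reals is the same forcing as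
  adding one. An infinite real of the large extension almost disjoint from all members of \<open>\<A>\<close> would
  therefore appear in a one-Cohen-real extension, where \<open>\<A>\<close> is MAD. A fin sequence of the large
  extension also appears there, together with a set \<open>I\<close> as in the definition of
  fin-intersecting. This \<open>I\<close> still works in the large extension: a finite subfamily of the traces is
  given by finitely many elements of \<open>\<A>\<close>, and whether their traces have infinite intersection is
  arithmetical in \<open>C\<close> and \<open>I\<close>, hence absolute.

  The proof has three parts. First, \<open>remains_MAD_and_fin_intersecting_iff\<close> eliminates the quantifiers
  over names for families: for an almost disjoint \<open>\<A>\<close>, the forced statement amounts to two density
  statements, \<open>every_real_meets\<close> and \<open>centers_fin_sequences\<close>, in which only elements and finite
  subsets of \<open>\<A>\<close> in the ground model and arithmetical sentences about names of reals occur.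
  Second, a projection \<open>\<pi>\<close> from \<open>P\<close> onto \<open>Q\<close> commutes with all arithmetical sentences, so
  both statements transfer from \<open>Q\<close> to those names over \<open>P\<close> whose membership relation depends
  only on the image of a condition under \<open>\<pi>\<close>. Third, \<open>ex_deciding_projection\<close> shows that every
  name for a real or for a sequence of reals is of this kind for a suitable projection onto the forcing
  for one Cohen real. The countable support that it restricts to is obtained by closing off: for each
  condition on it and each of the countably many sentences in question, it contains the support of an
  extension that decides the sentence.
\<close>


section \<open>Sentences as regular sets of conditions\<close>

context forcing_notion
begin

text \<open>
  The sentences that arise are regular open sets of conditions. On these the connectives, which are
  defined from negation, conjunction and universal quantification, have their expected forcing clauses.
\<close>
definition regular :: "'p sentence \<Rightarrow> bool" where
  "regular \<phi> \<longleftrightarrow> (\<forall>p\<in>P. \<phi> p \<longleftrightarrow> (\<forall>q\<in>P. q \<preceq> p \<longrightarrow> (\<exists>r\<in>P. r \<preceq> q \<and> \<phi> r)))"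

lemma regular_mono: "regular \<phi> \<Longrightarrow> p \<in> P \<Longrightarrow> q \<in> P \<Longrightarrow> q \<preceq> p \<Longrightarrow> \<phi> p \<Longrightarrow> \<phi> q"
  unfolding regular_def by (meson le_trans)

lemma regular_dense:
  "regular \<phi> \<Longrightarrow> p \<in> P \<Longrightarrow> (\<And>q. q \<in> P \<Longrightarrow> q \<preceq> p \<Longrightarrow> \<exists>r\<in>P. r \<preceq> q \<and> \<phi> r) \<Longrightarrow> \<phi> p"
  unfolding regular_def by blast

lemma regularI:
  assumes "\<And>p q. p \<in> P \<Longrightarrow> q \<in> P \<Longrightarrow> q \<preceq> p \<Longrightarrow> \<phi> p \<Longrightarrow> \<phi> q"
    and "\<And>p. p \<in> P \<Longrightarrow> (\<And>q. q \<in> P \<Longrightarrow> q \<preceq> p \<Longrightarrow> \<exists>r\<in>P. r \<preceq> q \<and> \<phi> r) \<Longrightarrow> \<phi> p"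
  shows "regular \<phi>"
  unfolding regular_def
proof (rule ballI, rule iffI)
  fix p assume p: "p \<in> P" "\<phi> p"
  show "\<forall>q\<in>P. q \<preceq> p \<longrightarrow> (\<exists>r\<in>P. r \<preceq> q \<and> \<phi> r)"
    using assms(1)[OF p(1) _ _ p(2)] le_refl by blast
next
  fix p assume "p \<in> P" "\<forall>q\<in>P. q \<preceq> p \<longrightarrow> (\<exists>r\<in>P. r \<preceq> q \<and> \<phi> r)"
  then show "\<phi> p" using assms(2) by simp
qed

lemma regular_Neg [simp]:
  assumes \<phi>: "regular \<phi>"
  shows "regular (\<^bold>\<not> \<phi>)"
proof (rule regularI)
  show "(\<^bold>\<not> \<phi>) q" if "p \<in> P" "q \<in> P" "q \<preceq> p" "(\<^bold>\<not> \<phi>) p" for p q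
    using that le_trans unfolding Neg_def by blast
  show "(\<^bold>\<not> \<phi>) p"
    if p: "p \<in> P"
      and dense: "\<And>q. q \<in> P \<Longrightarrow> q \<preceq> p \<Longrightarrow> \<exists>r\<in>P. r \<preceq> q \<and> (\<^bold>\<not> \<phi>) r" for p
    unfolding Neg_def
  proof (intro ballI impI notI)
    fix q assume q: "q \<in> P" "q \<preceq> p" "\<phi> q"
    obtain r where r: "r \<in> P" "r \<preceq> q" "(\<^bold>\<not> \<phi>) r" using dense[OF q(1,2)] by blast
    then have "\<phi> r" using regular_mono[OF \<phi> q(1) r(1,2) q(3)] by simp
    then show False using r le_refl unfolding Neg_def by blast
  qed
qed

lemma regular_Conj [simp]: "regular \<phi> \<Longrightarrow> regular \<psi> \<Longrightarrow> regular (\<phi> \<^bold>\<and> \<psi>)"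
  unfolding Conj_def
proof (rule regularI, goal_cases)
  case (1 p q)
  then show ?case using regular_mono by blast
next
  case (2 p)
  show ?case
    by (intro conjI; rule regular_dense[where p = p]) (use 2 in \<open>blast+\<close>)
qed

lemma regular_Impl [simp]: "regular \<phi> \<Longrightarrow> regular \<psi> \<Longrightarrow> regular (\<phi> \<^bold>\<longrightarrow> \<psi>)"
  unfolding Impl_def by simp

lemma regular_Iff [simp]: "regular \<phi> \<Longrightarrow> regular \<psi> \<Longrightarrow> regular (\<phi> \<^bold>\<longleftrightarrow> \<psi>)"
  unfolding Iff_def by simp

lemma regular_Forall [simp]: "(\<And>x. x \<in> N \<Longrightarrow> regular (\<phi> x)) \<Longrightarrow> regular (Forall N \<phi>)"
  unfolding Forall_def
proof (rule regularI, goal_cases)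
  case (1 p q)
  then show ?case using regular_mono by blast
next
  case (2 p)
  show ?case
    by (intro ballI; rule regular_dense[where p = p]) (use 2 in \<open>blast+\<close>)
qed

lemma regular_Exists [simp]: "(\<And>x. x \<in> N \<Longrightarrow> regular (\<phi> x)) \<Longrightarrow> regular (Exists N \<phi>)"
  unfolding Exists_def by simp

lemma regular_dense_below:
  "regular (dense_below D)"
proof (rule regularI)
  show "dense_below D q" if "p \<in> P" "q \<in> P" "q \<preceq> p" "dense_below D p" for p q
    using that unfolding dense_below_def by (meson le_trans)
  show "dense_below D p"
    if "p \<in> P" and *: "\<And>q. q \<in> P \<Longrightarrow> q \<preceq> p \<Longrightarrow> \<exists>r\<in>P. r \<preceq> q \<and> dense_below D r" for p
    unfolding dense_below_def
  proof (intro ballI impI)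
    fix q assume q: "q \<in> P" "q \<preceq> p"
    obtain r where r: "r \<in> P" "r \<preceq> q" "dense_below D r" using *[OF q] by blast
    then obtain s where "s \<in> P" "s \<preceq> r" "s \<in> D"
      using le_refl unfolding dense_below_def by blast
    then show "\<exists>r\<in>P. r \<preceq> q \<and> r \<in> D" using q r le_trans by blast
  qed
qed

lemma regular_Mem [simp]: "regular (n \<^bold>\<in> \<sigma>)"
  unfolding Mem_def by (rule regular_dense_below)

lemma regular_Eq [simp]: "regular (\<sigma> \<^bold>= \<tau>)"
  unfolding Eq_def by simp

lemma regular_MemF [simp]: "regular (\<sigma> \<^bold>\<in>\<^sub>F \<T>)"
  unfolding MemF_def by (rule regular_dense_below)

lemma regular_Fin [simp]: "(\<And>n. regular (\<phi> n)) \<Longrightarrow> regular (Fin \<phi>)"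
  unfolding Fin_def by simp

lemma regular_Infin [simp]: "(\<And>n. regular (\<phi> n)) \<Longrightarrow> regular (Infin \<phi>)"
  unfolding Infin_def by simp

lemma regular_FinF [simp]: "regular (FinF \<T>)"
  unfolding FinF_def by simp

lemma regular_AD_family [simp]: "regular (AD_family \<T>)"
  unfolding AD_family_def by simp

lemma regular_fin_sequence [simp]: "regular (fin_sequence C)"
  unfolding fin_sequence_def by simp

lemma regular_traces [simp]: "regular (traces \<T> C I x)"
  unfolding traces_def by simp

lemma regular_centered [simp]: "(\<And>x. regular (\<Phi> x)) \<Longrightarrow> regular (centered \<Phi>)"
  unfolding centered_def by simp

lemma Conj_iff: "(\<phi> \<^bold>\<and> \<psi>) p \<longleftrightarrow> \<phi> p \<and> \<psi> p"
  by (simp add: Conj_def)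

lemma Neg_iff: "(\<^bold>\<not> \<phi>) p \<longleftrightarrow> (\<forall>q\<in>P. q \<preceq> p \<longrightarrow> \<not> \<phi> q)"
  by (simp add: Neg_def)

lemma Forall_iff: "Forall N \<phi> p \<longleftrightarrow> (\<forall>x\<in>N. \<phi> x p)"
  by (simp add: Forall_def)

text \<open>
  The definition as \<open>\<not> (\<phi> \<and> \<not> \<psi>)\<close> only yields a dense set of conditions forcing \<open>\<psi>\<close> below a
  condition that forces \<open>\<phi>\<close>; regularity of \<open>\<psi>\<close> then gives \<open>\<psi>\<close> itself.
\<close>
lemma Impl_iff:
  assumes "regular \<phi>" "regular \<psi>" "p \<in> P"
  shows "(\<phi> \<^bold>\<longrightarrow> \<psi>) p \<longleftrightarrow> (\<forall>q\<in>P. q \<preceq> p \<longrightarrow> \<phi> q \<longrightarrow> \<psi> q)"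
proof
  assume *: "(\<phi> \<^bold>\<longrightarrow> \<psi>) p"
  show "\<forall>q\<in>P. q \<preceq> p \<longrightarrow> \<phi> q \<longrightarrow> \<psi> q"
  proof (intro ballI impI)
    fix q assume q: "q \<in> P" "q \<preceq> p" "\<phi> q"
    show "\<psi> q"
    proof (rule regular_dense[OF assms(2) q(1)])
      fix r assume r: "r \<in> P" "r \<preceq> q"
      then have "r \<preceq> p" "\<phi> r" using q assms le_trans regular_mono by blast+
      then show "\<exists>s\<in>P. s \<preceq> r \<and> \<psi> s"
        using * r unfolding Impl_def Neg_def Conj_def by blast
    qed
  qed
next
  assume "\<forall>q\<in>P. q \<preceq> p \<longrightarrow> \<phi> q \<longrightarrow> \<psi> q"
  then show "(\<phi> \<^bold>\<longrightarrow> \<psi>) p"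
    unfolding Impl_def Neg_def Conj_def using le_refl by blast
qed

lemma Iff_iff:
  "regular \<phi> \<Longrightarrow> regular \<psi> \<Longrightarrow> p \<in> P \<Longrightarrow>
     (\<phi> \<^bold>\<longleftrightarrow> \<psi>) p \<longleftrightarrow> (\<forall>q\<in>P. q \<preceq> p \<longrightarrow> (\<phi> q \<longleftrightarrow> \<psi> q))"
  unfolding Iff_def by (auto simp: Conj_iff Impl_iff)

lemma Exists_iff: "Exists N \<phi> p \<longleftrightarrow> (\<forall>q\<in>P. q \<preceq> p \<longrightarrow> (\<exists>r\<in>P. r \<preceq> q \<and> (\<exists>x\<in>N. \<phi> x r)))"
  unfolding Exists_def Neg_def Forall_def by blast

lemma Eq_iff: "p \<in> P \<Longrightarrow> (\<sigma> \<^bold>= \<tau>) p \<longleftrightarrow> (\<forall>q\<in>P. q \<preceq> p \<longrightarrow> (\<forall>n. (n \<^bold>\<in> \<sigma>) q \<longleftrightarrow> (n \<^bold>\<in> \<tau>) q))"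
  unfolding Eq_def by (auto simp: Forall_iff Iff_iff)

lemma Eq_refl: "p \<in> P \<Longrightarrow> (\<sigma> \<^bold>= \<sigma>) p"
  by (simp add: Eq_iff)

lemma Eq_sym: "p \<in> P \<Longrightarrow> (\<sigma> \<^bold>= \<tau>) p \<Longrightarrow> (\<tau> \<^bold>= \<sigma>) p"
  by (simp add: Eq_iff)

lemma Eq_trans: "p \<in> P \<Longrightarrow> (\<sigma> \<^bold>= \<tau>) p \<Longrightarrow> (\<tau> \<^bold>= \<upsilon>) p \<Longrightarrow> (\<sigma> \<^bold>= \<upsilon>) p"
  by (simp add: Eq_iff)

lemma Mem_Eq: "p \<in> P \<Longrightarrow> (\<sigma> \<^bold>= \<tau>) p \<Longrightarrow> (n \<^bold>\<in> \<sigma>) p \<longleftrightarrow> (n \<^bold>\<in> \<tau>) p"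
  using le_refl by (auto simp: Eq_iff)

lemma MemF_iff:
  "(\<sigma> \<^bold>\<in>\<^sub>F \<T>) p \<longleftrightarrow>
     (\<forall>q\<in>P. q \<preceq> p \<longrightarrow> (\<exists>r\<in>P. r \<preceq> q \<and> (\<exists>(\<pi>, u)\<in>\<T>. r \<preceq> u \<and> (\<sigma> \<^bold>= \<pi>) r)))"
  unfolding MemF_def dense_below_def by (simp add: Bex_def)

lemma MemFI:
  assumes "(\<pi>, u) \<in> \<T>" "u \<in> P" "p \<in> P" "p \<preceq> u" "(\<sigma> \<^bold>= \<pi>) p"
  shows "(\<sigma> \<^bold>\<in>\<^sub>F \<T>) p"
proof -
  have "\<exists>r\<in>P. r \<preceq> q \<and> (\<exists>(\<pi>, u)\<in>\<T>. r \<preceq> u \<and> (\<sigma> \<^bold>= \<pi>) r)" if q: "q \<in> P" "q \<preceq> p" for q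
  proof (rule bexI[of _ q])
    have "q \<preceq> u" "(\<sigma> \<^bold>= \<pi>) q"
      using assms q le_trans regular_mono[OF regular_Eq] by blast+
    then show "q \<preceq> q \<and> (\<exists>(\<pi>, u)\<in>\<T>. q \<preceq> u \<and> (\<sigma> \<^bold>= \<pi>) q)"
      using assms(1) q le_refl by blast
  qed (rule q)
  then show ?thesis by (simp add: MemF_iff)
qed

lemma MemF_Eq:
  assumes "p \<in> P" "(\<sigma> \<^bold>= \<tau>) p" "(\<sigma> \<^bold>\<in>\<^sub>F \<T>) p"
  shows "(\<tau> \<^bold>\<in>\<^sub>F \<T>) p"
  unfolding MemF_iff
proof (intro ballI impI)
  fix q assume q: "q \<in> P" "q \<preceq> p"
  then obtain r \<pi> u where r: "r \<in> P" "r \<preceq> q" "(\<pi>, u) \<in> \<T>" "r \<preceq> u" "(\<sigma> \<^bold>= \<pi>) r"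
    using assms(3) unfolding MemF_iff by blast
  have "(\<sigma> \<^bold>= \<tau>) r"
    using assms q r le_trans regular_mono[OF regular_Eq] by meson
  then show "\<exists>r\<in>P. r \<preceq> q \<and> (\<exists>(\<pi>, u)\<in>\<T>. r \<preceq> u \<and> (\<tau> \<^bold>= \<pi>) r)"
    using r Eq_sym Eq_trans by blast
qed

lemma Mem_check [simp]: "p \<in> P \<Longrightarrow> (n \<^bold>\<in> check a) p \<longleftrightarrow> n \<in> a"
  unfolding Mem_def dense_below_def check_def using le_refl le_one by auto

lemma check_in_real_names [simp]: "check a \<in> real_names"
  using one_in by (auto simp: check_def real_names_def)

lemma check_family_in_family_names [simp]: "check_family A \<in> family_names"
  using one_in check_in_real_names by (auto simp: check_family_def family_names_def)

lemma Eq_check: "p \<in> P \<Longrightarrow> (check a \<^bold>= check b) p \<Longrightarrow> a = b"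
  using le_refl by (auto simp: Eq_iff)

lemma MemF_check_family:
  "(\<sigma> \<^bold>\<in>\<^sub>F check_family A) p \<longleftrightarrow>
     (\<forall>q\<in>P. q \<preceq> p \<longrightarrow> (\<exists>r\<in>P. r \<preceq> q \<and> (\<exists>a\<in>A. (\<sigma> \<^bold>= check a) r)))"
  unfolding MemF_iff check_family_def using le_one by fastforce

lemma check_MemF_check_family: "a \<in> A \<Longrightarrow> p \<in> P \<Longrightarrow> (check a \<^bold>\<in>\<^sub>F check_family A) p"
  by (rule MemFI[of "check a" \<one>]) (auto simp: check_family_def one_in le_one Eq_refl)

definition name_of :: "(nat \<Rightarrow> 'p sentence) \<Rightarrow> 'p real_name" where
  "name_of \<phi> = {(n, p). p \<in> P \<and> \<phi> n p}"

lemma name_of_in_real_names [simp]: "name_of \<phi> \<in> real_names"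
  by (auto simp: name_of_def real_names_def)

lemma Mem_name_of:
  assumes "regular (\<phi> n)" "p \<in> P"
  shows "(n \<^bold>\<in> name_of \<phi>) p \<longleftrightarrow> \<phi> n p"
proof -
  have "r \<in> {r. \<exists>q. (n, q) \<in> name_of \<phi> \<and> r \<preceq> q} \<longleftrightarrow> \<phi> n r" if "r \<in> P" for r
    using that assms regular_mono le_refl by (auto simp: name_of_def)
  then have "(n \<^bold>\<in> name_of \<phi>) p \<longleftrightarrow> (\<forall>q\<in>P. q \<preceq> p \<longrightarrow> (\<exists>r\<in>P. r \<preceq> q \<and> \<phi> n r))"
    unfolding Mem_def dense_below_def by blast
  then show ?thesis using assms unfolding regular_def by blast
qed

text \<open>
  Finitely many dense open requirements are met by a single condition. This is how finite families of
  the extension get identified with finite families of the ground model.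
\<close>
lemma finite_dense:
  assumes "finite N" "p \<in> P"
    and "\<And>i q r. i \<in> N \<Longrightarrow> q \<in> P \<Longrightarrow> r \<in> P \<Longrightarrow> r \<preceq> q \<Longrightarrow> D i q \<Longrightarrow> D i r"
    and "\<And>i q. i \<in> N \<Longrightarrow> q \<in> P \<Longrightarrow> q \<preceq> p \<Longrightarrow> \<exists>r\<in>P. r \<preceq> q \<and> D i r"
  shows "\<exists>q\<in>P. q \<preceq> p \<and> (\<forall>i\<in>N. D i q)"
  using assms
proof (induction N rule: finite_induct)
  case empty
  then show ?case using le_refl by blast
next
  case (insert i N)
  then have "\<exists>q\<in>P. q \<preceq> p \<and> (\<forall>j\<in>N. D j q)" by simp
  then obtain q where q: "q \<in> P" "q \<preceq> p" "\<forall>j\<in>N. D j q" by blast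
  obtain r where r: "r \<in> P" "r \<preceq> q" "D i r" using insert.prems(3)[OF _ q(1,2)] by blast
  have "\<forall>j\<in>N. D j r" using insert.prems(2) q r by blast
  then show ?case using r q insert.prems(1) le_trans by blast
qed

text \<open>
  The definition of \<open>Infin\<close> quantifies over finite sets and says that no condition below \<open>p\<close> forces
  the set to equal one of them. If some \<open>q\<close> forces it to be bounded by \<open>m\<close>, then by \<open>finite_dense\<close>
  densely many conditions below \<open>q\<close> decide it below \<open>m\<close> and thus determine it as a finite set.
\<close>
lemma Infin_iff:
  assumes \<phi>: "\<And>n. regular (\<phi> n)" and p: "p \<in> P"
  shows "Infin \<phi> p \<longleftrightarrow> (\<forall>q\<in>P. q \<preceq> p \<longrightarrow> (\<forall>m. \<exists>n\<ge>m. \<exists>r\<in>P. r \<preceq> q \<and> \<phi> n r))"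
proof -
  have Fin_iff: "Fin \<phi> q \<longleftrightarrow> (\<forall>s\<in>P. s \<preceq> q \<longrightarrow> (\<exists>r\<in>P. r \<preceq> s \<and>
      (\<exists>F. finite F \<and> (\<forall>t\<in>P. t \<preceq> r \<longrightarrow> (\<forall>n. \<phi> n t \<longleftrightarrow> n \<in> F)))))" if "q \<in> P" for q
  proof -
    have "(\<^bold>\<forall>\<^sub>\<omega>n. \<phi> n \<^bold>\<longleftrightarrow> n \<^bold>\<in> check F) r \<longleftrightarrow>
        (\<forall>t\<in>P. t \<preceq> r \<longrightarrow> (\<forall>n. \<phi> n t \<longleftrightarrow> n \<in> F))" if "r \<in> P" for r F
      using that \<phi> by (auto simp: Forall_iff Iff_iff)
    then have *: "(\<exists>F\<in>{F. finite F}. (\<^bold>\<forall>\<^sub>\<omega>n. \<phi> n \<^bold>\<longleftrightarrow> n \<^bold>\<in> check F) r) \<longleftrightarrow>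
        (\<exists>F. finite F \<and> (\<forall>t\<in>P. t \<preceq> r \<longrightarrow> (\<forall>n. \<phi> n t \<longleftrightarrow> n \<in> F)))" if "r \<in> P" for r
      using that by simp
    then show ?thesis
      unfolding Fin_def Exists_iff by (intro ball_cong bex_cong imp_cong conj_cong refl *)
  qed
  show ?thesis
  proof
    assume *: "Infin \<phi> p"
    show "\<forall>q\<in>P. q \<preceq> p \<longrightarrow> (\<forall>m. \<exists>n\<ge>m. \<exists>r\<in>P. r \<preceq> q \<and> \<phi> n r)"
    proof (intro ballI impI allI, rule ccontr)
      fix q m assume q: "q \<in> P" "q \<preceq> p" and no: "\<not> (\<exists>n\<ge>m. \<exists>r\<in>P. r \<preceq> q \<and> \<phi> n r)"
      have "Fin \<phi> q"
        unfolding Fin_iff[OF q(1)]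
      proof (intro ballI impI)
        fix s assume s: "s \<in> P" "s \<preceq> q"
        have "\<exists>r\<in>P. r \<preceq> s \<and> (\<forall>n\<in>{..<m}. \<phi> n r \<or> (\<^bold>\<not> \<phi> n) r)"
        proof (rule finite_dense)
          show "\<phi> n r \<or> (\<^bold>\<not> \<phi> n) r"
            if "q \<in> P" "r \<in> P" "r \<preceq> q" "\<phi> n q \<or> (\<^bold>\<not> \<phi> n) q" for n q r
            using that(4) regular_mono[OF \<phi> that(1-3)]
              regular_mono[OF regular_Neg[OF \<phi>] that(1-3)] by blast
          show "\<exists>r\<in>P. r \<preceq> q \<and> (\<phi> n r \<or> (\<^bold>\<not> \<phi> n) r)" if "q \<in> P" for q n
            using that le_refl unfolding Neg_iff by blast
        qed (use s in auto)
        then obtain r where r: "r \<in> P" "r \<preceq> s" "\<forall>n<m. \<phi> n r \<or> (\<^bold>\<not> \<phi> n) r" by blast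
        have "\<phi> n t \<longleftrightarrow> n \<in> {n. n < m \<and> \<phi> n r}" if t: "t \<in> P" "t \<preceq> r" for t n
        proof (cases "n < m")
          case True
          then show ?thesis using r t regular_mono[OF \<phi>] unfolding Neg_iff by blast
        next
          case False
          have "t \<preceq> q" using t r s q le_trans by meson
          then show ?thesis using False no t by auto
        qed
        moreover have "finite {n. n < m \<and> \<phi> n r}" by simp
        ultimately show "\<exists>r\<in>P. r \<preceq> s \<and>
            (\<exists>F. finite F \<and> (\<forall>t\<in>P. t \<preceq> r \<longrightarrow> (\<forall>n. \<phi> n t \<longleftrightarrow> n \<in> F)))"
          using r by blast
      qed
      then show False using * q unfolding Infin_def Neg_iff by blast
    qed
  next
    assume *: "\<forall>q\<in>P. q \<preceq> p \<longrightarrow> (\<forall>m. \<exists>n\<ge>m. \<exists>r\<in>P. r \<preceq> q \<and> \<phi> n r)"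
    show "Infin \<phi> p"
      unfolding Infin_def Neg_iff
    proof (intro ballI impI notI)
      fix q assume q: "q \<in> P" "q \<preceq> p" "Fin \<phi> q"
      obtain r F where r: "r \<in> P" "r \<preceq> q" "finite F"
        "\<forall>t\<in>P. t \<preceq> r \<longrightarrow> (\<forall>n. \<phi> n t \<longleftrightarrow> n \<in> F)"
        using Fin_iff[OF q(1), THEN iffD1, OF q(3), rule_format, OF q(1) le_refl[OF q(1)]]
        by blast
      obtain m where m: "\<forall>n\<in>F. n < m" using r(3) finite_nat_set_iff_bounded by blast
      have "r \<preceq> p" using r q p le_trans by blast
      then obtain n t where "n \<ge> m" "t \<in> P" "t \<preceq> r" "\<phi> n t" using * r by blast
      then show False using r m by fastforce
    qed
  qed
qed

lemma Fin_iff_Neg_Infin: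
  assumes "\<And>n. regular (\<phi> n)" "p \<in> P"
  shows "Fin \<phi> p \<longleftrightarrow> (\<^bold>\<not> Infin \<phi>) p"
proof -
  have "Fin \<phi> p \<longleftrightarrow> (\<forall>q\<in>P. q \<preceq> p \<longrightarrow> (\<exists>r\<in>P. r \<preceq> q \<and> Fin \<phi> r))"
    using regular_Fin[OF assms(1)] assms(2) unfolding regular_def by (rule bspec)
  then show ?thesis unfolding Infin_def Neg_iff by simp
qed

lemma Infin_mono:
  assumes "Infin \<phi> p" "p \<in> P" "\<And>n. regular (\<phi> n)" "\<And>n. regular (\<psi> n)"
    and "\<And>n q. q \<in> P \<Longrightarrow> q \<preceq> p \<Longrightarrow> \<phi> n q \<Longrightarrow> \<psi> n q"
  shows "Infin \<psi> p"
  unfolding Infin_iff[OF assms(4,2)]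
proof (intro ballI impI allI)
  fix q m assume q: "q \<in> P" "q \<preceq> p"
  then obtain n r where r: "n \<ge> m" "r \<in> P" "r \<preceq> q" "\<phi> n r"
    using assms(1) unfolding Infin_iff[OF assms(3,2)] by blast
  then have "\<psi> n r" using assms(5)[of r n] q assms(2) le_trans by blast
  then show "\<exists>n\<ge>m. \<exists>r\<in>P. r \<preceq> q \<and> \<psi> n r" using r by blast
qed

lemma Fin_mono:
  assumes "Fin \<psi> p" "p \<in> P" "\<And>n. regular (\<phi> n)" "\<And>n. regular (\<psi> n)"
    and "\<And>n q. q \<in> P \<Longrightarrow> q \<preceq> p \<Longrightarrow> \<phi> n q \<Longrightarrow> \<psi> n q"
  shows "Fin \<phi> p"
proof -
  have "\<not> Infin \<phi> q" if q: "q \<in> P" "q \<preceq> p" for q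
  proof
    assume "Infin \<phi> q"
    then have "Infin \<psi> q"
      by (rule Infin_mono) (use assms q le_trans in \<open>blast+\<close>)
    then show False
      using assms q by (auto simp: Fin_iff_Neg_Infin Neg_iff)
  qed
  then show ?thesis using assms by (simp add: Fin_iff_Neg_Infin Neg_iff)
qed

lemma Infin_ground:
  assumes "p \<in> P" "\<And>n q. q \<in> P \<Longrightarrow> \<phi> n q \<longleftrightarrow> n \<in> a" "\<And>n. regular (\<phi> n)"
  shows "Infin \<phi> p \<longleftrightarrow> infinite a"
proof -
  have "(\<exists>n\<ge>m. \<exists>r\<in>P. r \<preceq> q \<and> \<phi> n r) \<longleftrightarrow> (\<exists>n\<ge>m. n \<in> a)" if "q \<in> P" for q m
    using that assms(2) le_refl by blast
  then have "Infin \<phi> p \<longleftrightarrow> (\<forall>q\<in>P. q \<preceq> p \<longrightarrow> (\<forall>m. \<exists>n\<ge>m. n \<in> a))"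
    using assms by (simp add: Infin_iff)
  then show ?thesis
    unfolding infinite_nat_iff_unbounded_le using assms(1) le_refl by blast
qed

section \<open>Almost disjoint families in the extension\<close>

lemma ExistsI: "p \<in> P \<Longrightarrow> x \<in> N \<Longrightarrow> regular (\<phi> x) \<Longrightarrow> \<phi> x p \<Longrightarrow> Exists N \<phi> p"
  unfolding Exists_iff using regular_mono[of "\<phi> x" p] le_refl by blast

lemma ExistsD: "Exists N \<phi> p \<Longrightarrow> p \<in> P \<Longrightarrow> \<exists>q\<in>P. q \<preceq> p \<and> (\<exists>x\<in>N. \<phi> x q)"
  unfolding Exists_iff using le_refl by blast

lemma ex_Neg_if_not:
  assumes "regular \<phi>" "p \<in> P" "\<not> \<phi> p"
  shows "\<exists>q\<in>P. q \<preceq> p \<and> (\<^bold>\<not> \<phi>) q"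
  using regular_dense[OF assms(1,2)] assms(3) unfolding Neg_iff by blast

lemma Infin_if_not_Fin_below: "(\<And>q. q \<in> P \<Longrightarrow> q \<preceq> p \<Longrightarrow> \<not> Fin \<phi> q) \<Longrightarrow> Infin \<phi> p"
  by (simp add: Infin_def Neg_iff)

lemma Fin_if_not_Infin_below:
  "p \<in> P \<Longrightarrow> (\<And>n. regular (\<phi> n)) \<Longrightarrow> (\<And>q. q \<in> P \<Longrightarrow> q \<preceq> p \<Longrightarrow> \<not> Infin \<phi> q) \<Longrightarrow> Fin \<phi> p"
  by (simp add: Fin_iff_Neg_Infin Neg_iff)

lemma Infin_not_Fin: "p \<in> P \<Longrightarrow> Infin \<phi> p \<Longrightarrow> \<not> Fin \<phi> p"
  using le_refl by (auto simp: Infin_def Neg_iff)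

lemma regular_SubF [simp]: "regular (\<S> \<^bold>\<subseteq>\<^sub>F \<T>)"
  unfolding SubF_def by simp

lemma regular_EqF [simp]: "regular (\<S> \<^bold>=\<^sub>F \<T>)"
  unfolding EqF_def by simp

lemma MemF_mono: "(\<sigma> \<^bold>\<in>\<^sub>F \<S>) p \<Longrightarrow> \<S> \<subseteq> \<T> \<Longrightarrow> (\<sigma> \<^bold>\<in>\<^sub>F \<T>) p"
  unfolding MemF_iff by blast

text \<open>
  Descending to \<open>q\<close> fixes both the bound \<open>n\<close> and the name \<open>s\<close> of the enumeration.
\<close>
lemma FinF_E:
  assumes "FinF \<T> p" "p \<in> P"
  obtains q n s where "q \<in> P" "q \<preceq> p" "s \<in> sequence_names"
    "\<And>x t. x \<in> real_names \<Longrightarrow> t \<in> P \<Longrightarrow> t \<preceq> q \<Longrightarrow>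
       (x \<^bold>\<in>\<^sub>F \<T>) t \<longleftrightarrow> Exists {..<n} (\<lambda>i. x \<^bold>= s i) t"
proof -
  obtain r n where r: "r \<in> P" "r \<preceq> p"
    "(\<^bold>\<exists>\<^sub>ss. \<^bold>\<forall>\<^sub>rx. x \<^bold>\<in>\<^sub>F \<T> \<^bold>\<longleftrightarrow> Exists {..<n} (\<lambda>i. x \<^bold>= s i)) r"
    using ExistsD[OF assms(1)[unfolded FinF_def] assms(2)] by blast
  obtain q s where q: "q \<in> P" "q \<preceq> r" "s \<in> sequence_names"
    "(\<^bold>\<forall>\<^sub>rx. x \<^bold>\<in>\<^sub>F \<T> \<^bold>\<longleftrightarrow> Exists {..<n} (\<lambda>i. x \<^bold>= s i)) q"
    using ExistsD[OF r(3,1)] by blast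
  have "(x \<^bold>\<in>\<^sub>F \<T>) t \<longleftrightarrow> Exists {..<n} (\<lambda>i. x \<^bold>= s i) t"
    if "x \<in> real_names" "t \<in> P" "t \<preceq> q" for x t
    using q(1,4) that by (simp add: Forall_iff Iff_iff)
  then show ?thesis using that q r assms(2) le_trans by blast
qed

lemma FinF_image:
  assumes F: "finite F" "\<And>a. a \<in> F \<Longrightarrow> f a \<in> real_names" and p: "p \<in> P"
  shows "FinF (f ` F \<times> {\<one>}) p"
proof -
  obtain h where h: "bij_betw h {0..<card F} F"
    using ex_bij_betw_nat_finite F(1) by blast
  define s where "s = (\<lambda>i. if i < card F then f (h i) else {})"
  have F_eq: "F = h ` {..<card F}"
    using h by (simp add: bij_betw_def atLeast0LessThan)
  then have s: "s \<in> sequence_names"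
    using F(2) by (auto simp: s_def sequence_names_def real_names_def)
  have *: "(\<exists>(\<pi>, u)\<in>f ` F \<times> {\<one>}. r \<preceq> u \<and> (x \<^bold>= \<pi>) r) \<longleftrightarrow> (\<exists>i\<in>{..<card F}. (x \<^bold>= s i) r)"
    if "r \<in> P" for r x
    by (subst F_eq) (use that in \<open>auto simp: s_def le_one\<close>)
  have "(x \<^bold>\<in>\<^sub>F f ` F \<times> {\<one>}) t \<longleftrightarrow> Exists {..<card F} (\<lambda>i. x \<^bold>= s i) t" for x t
    unfolding MemF_iff Exists_iff by (intro ball_cong bex_cong imp_cong conj_cong refl *)
  then have "(\<^bold>\<forall>\<^sub>rx. x \<^bold>\<in>\<^sub>F f ` F \<times> {\<one>} \<^bold>\<longleftrightarrow> Exists {..<card F} (\<lambda>i. x \<^bold>= s i)) p"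
    using p by (simp add: Forall_iff Iff_iff)
  then show ?thesis
    unfolding FinF_def by (intro ExistsI[of p "card F"] ExistsI[of p s] p s) simp_all
qed

text \<open>
  If the family were enumerated by \<open>s 0, \<dots>, s (n - 1)\<close>, take \<open>n + 1\<close> distinct elements of \<open>A\<close> and
  a condition that decides at which index each of them occurs. By the pigeonhole principle this condition
  forces two different ground model sets to be equal.
\<close>
lemma not_FinF_if_infinite:
  assumes A: "infinite A" "\<And>a q. a \<in> A \<Longrightarrow> q \<in> P \<Longrightarrow> (check a \<^bold>\<in>\<^sub>F \<T>) q"
  shows "(\<^bold>\<not> FinF \<T>) p"
  unfolding Neg_iff
proof (intro ballI impI notI)
  fix q assume "q \<in> P" "q \<preceq> p" "FinF \<T> q"
  from this(3,1) obtain r n s where r: "r \<in> P" "r \<preceq> q" "s \<in> sequence_names"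
    and eq: "\<And>x t. x \<in> real_names \<Longrightarrow> t \<in> P \<Longrightarrow> t \<preceq> r \<Longrightarrow>
       (x \<^bold>\<in>\<^sub>F \<T>) t \<longleftrightarrow> Exists {..<n} (\<lambda>i. x \<^bold>= s i) t"
    by (rule FinF_E) blast
  obtain B where B: "B \<subseteq> A" "finite B" "card B = Suc n"
    using infinite_arbitrarily_large[OF A(1)] by blast
  have "\<exists>t\<in>P. t \<preceq> r \<and> (\<forall>a\<in>B. \<exists>i<n. (check a \<^bold>= s i) t)"
  proof (rule finite_dense[OF B(2) r(1)])
    show "\<exists>i<n. (check a \<^bold>= s i) v"
      if "u \<in> P" "v \<in> P" "v \<preceq> u" "\<exists>i<n. (check a \<^bold>= s i) u" for a u v
      using that(4) regular_mono[OF regular_Eq that(1-3)] by blast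
    show "\<exists>v\<in>P. v \<preceq> u \<and> (\<exists>i<n. (check a \<^bold>= s i) v)"
      if "a \<in> B" "u \<in> P" "u \<preceq> r" for a u
    proof -
      have "Exists {..<n} (\<lambda>i. check a \<^bold>= s i) u"
        using eq[of "check a" u] A(2)[of a u] B(1) that by auto
      then show ?thesis using ExistsD that(2) by blast
    qed
  qed
  then obtain t where t: "t \<in> P" "\<forall>a\<in>B. \<exists>i<n. (check a \<^bold>= s i) t" by blast
  obtain f where f: "\<And>a. a \<in> B \<Longrightarrow> f a < n" "\<And>a. a \<in> B \<Longrightarrow> (check a \<^bold>= s (f a)) t"
    using bchoice[OF t(2)] by blast
  have "card (f ` B) \<le> n"
    using card_mono[of "{..<n}" "f ` B"] f(1) by (simp add: image_subset_iff)
  then have "\<not> inj_on f B" using B(3) card_image[of f B] by linarith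
  then obtain a b where ab: "a \<in> B" "b \<in> B" "f a = f b" "a \<noteq> b" by (auto simp: inj_on_def)
  then have "(check b \<^bold>= s (f a)) t" using f(2)[of b] by simp
  then have "(check a \<^bold>= check b) t"
    using Eq_trans[OF t(1) f(2)[OF ab(1)]] Eq_sym[OF t(1)] by blast
  then show False using Eq_check t(1) ab by blast
qed

text \<open>
  A condition that forces \<open>x\<close> to be an element of \<open>\<T>\<close> has densely many extensions that force \<open>x\<close> to
  equal one of the names listed in \<open>\<T>\<close>. Since \<open>Fin\<close> and \<open>Infin\<close> are regular, it suffices to treat
  the names listed.
\<close>
lemma AD_familyI:
  assumes p: "p \<in> P" and notfin: "(\<^bold>\<not> FinF \<T>) p"
    and inf: "\<And>\<pi> u q. (\<pi>, u) \<in> \<T> \<Longrightarrow> q \<in> P \<Longrightarrow> q \<preceq> p \<Longrightarrow> q \<preceq> u \<Longrightarrow> Infin (\<lambda>n. n \<^bold>\<in> \<pi>) q"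
    and fin: "\<And>\<pi> u \<pi>' u' q. (\<pi>, u) \<in> \<T> \<Longrightarrow> (\<pi>', u') \<in> \<T> \<Longrightarrow> q \<in> P \<Longrightarrow> q \<preceq> p \<Longrightarrow>
      q \<preceq> u \<Longrightarrow> q \<preceq> u' \<Longrightarrow> (\<^bold>\<not> \<pi> \<^bold>= \<pi>') q \<Longrightarrow> Fin (\<lambda>n. n \<^bold>\<in> \<pi> \<^bold>\<and> n \<^bold>\<in> \<pi>') q"
    and conds: "\<And>\<pi> u. (\<pi>, u) \<in> \<T> \<Longrightarrow> u \<in> P"
  shows "AD_family \<T> p"
proof -
  have "Infin (\<lambda>n. n \<^bold>\<in> a) q" if q: "q \<in> P" "q \<preceq> p" and a: "(a \<^bold>\<in>\<^sub>F \<T>) q" for a q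
  proof (rule regular_dense[OF _ q(1)])
    fix r assume r: "r \<in> P" "r \<preceq> q"
    then obtain v \<pi> u where v: "v \<in> P" "v \<preceq> r" "(\<pi>, u) \<in> \<T>" "v \<preceq> u" "(a \<^bold>= \<pi>) v"
      using a unfolding MemF_iff by blast
    have "v \<preceq> p" using v r q p le_trans by meson
    then have "Infin (\<lambda>n. n \<^bold>\<in> \<pi>) v" using inf v by blast
    then have "Infin (\<lambda>n. n \<^bold>\<in> a) v"
      by (rule Infin_mono) (use v in \<open>auto simp: Eq_iff\<close>)
    then show "\<exists>r'\<in>P. r' \<preceq> r \<and> Infin (\<lambda>n. n \<^bold>\<in> a) r'" using v by blast
  qed simp
  moreover have "Fin (\<lambda>n. n \<^bold>\<in> a \<^bold>\<and> n \<^bold>\<in> b) q"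
    if q: "q \<in> P" "q \<preceq> p" and ab: "(a \<^bold>\<in>\<^sub>F \<T>) q" "(b \<^bold>\<in>\<^sub>F \<T>) q" "(\<^bold>\<not> a \<^bold>= b) q" for a b q
  proof (rule regular_dense[OF _ q(1)])
    fix r assume r: "r \<in> P" "r \<preceq> q"
    then obtain v \<pi> u where v: "v \<in> P" "v \<preceq> r" "(\<pi>, u) \<in> \<T>" "v \<preceq> u" "(a \<^bold>= \<pi>) v"
      using ab(1) unfolding MemF_iff by blast
    have "v \<preceq> q" using v r q le_trans by meson
    then obtain v' \<pi>' u' where v': "v' \<in> P" "v' \<preceq> v" "(\<pi>', u') \<in> \<T>" "v' \<preceq> u'" "(b \<^bold>= \<pi>') v'"
      using ab(2) v(1) unfolding MemF_iff by blast
    have le: "v' \<preceq> r" "v' \<preceq> q" "v' \<preceq> p" "v' \<preceq> u"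
      using v v' r q p conds[OF v(3)] le_trans by meson+
    have eq: "(a \<^bold>= \<pi>) v'" "(\<^bold>\<not> a \<^bold>= b) v'"
      using regular_mono[OF regular_Eq v(1) v'(1,2) v(5)]
        regular_mono[OF regular_Neg[OF regular_Eq] q(1) v'(1) le(2) ab(3)] by blast+
    have "(\<^bold>\<not> \<pi> \<^bold>= \<pi>') v'"
      unfolding Neg_iff
    proof (intro ballI impI notI)
      fix w assume w: "w \<in> P" "w \<preceq> v'" "(\<pi> \<^bold>= \<pi>') w"
      have "(a \<^bold>= \<pi>) w" "(b \<^bold>= \<pi>') w"
        using regular_mono[OF regular_Eq v'(1) w(1,2)] eq(1) v'(5) by blast+
      then have "(a \<^bold>= b) w" using Eq_trans[OF w(1)] Eq_sym[OF w(1)] w(3) by blast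
      then show False using eq(2) w(1,2) by (simp add: Neg_iff)
    qed
    then have "Fin (\<lambda>n. n \<^bold>\<in> \<pi> \<^bold>\<and> n \<^bold>\<in> \<pi>') v'" using fin v v' le by blast
    then have "Fin (\<lambda>n. n \<^bold>\<in> a \<^bold>\<and> n \<^bold>\<in> b) v'"
      by (rule Fin_mono) (use v' eq in \<open>auto simp: Eq_iff Conj_iff\<close>)
    then show "\<exists>r'\<in>P. r' \<preceq> r \<and> Fin (\<lambda>n. n \<^bold>\<in> a \<^bold>\<and> n \<^bold>\<in> b) r'" using v' le by blast
  qed simp
  ultimately show ?thesis
    using p notfin unfolding AD_family_def by (simp add: Conj_iff Forall_iff Impl_iff)
qed

lemma AD_family_Infin:
  assumes "AD_family \<T> p" "p \<in> P" "a \<in> real_names" "q \<in> P" "q \<preceq> p" "(a \<^bold>\<in>\<^sub>F \<T>) q"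
  shows "Infin (\<lambda>n. n \<^bold>\<in> a) q"
  using assms unfolding AD_family_def by (simp add: Conj_iff Forall_iff Impl_iff)

lemma AD_family_Fin:
  assumes "AD_family \<T> p" "p \<in> P" "a \<in> real_names" "b \<in> real_names" "q \<in> P" "q \<preceq> p"
    and "(a \<^bold>\<in>\<^sub>F \<T>) q" "(b \<^bold>\<in>\<^sub>F \<T>) q" "(\<^bold>\<not> a \<^bold>= b) q"
  shows "Fin (\<lambda>n. n \<^bold>\<in> a \<^bold>\<and> n \<^bold>\<in> b) q"
  using assms unfolding AD_family_def by (simp add: Conj_iff Forall_iff Impl_iff)

lemma Infin_check: "infinite a \<Longrightarrow> p \<in> P \<Longrightarrow> Infin (\<lambda>n. n \<^bold>\<in> check a) p"
  using Infin_ground[of p "\<lambda>n. n \<^bold>\<in> check a" a] by simp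

lemma Fin_check_Int:
  assumes "finite (a \<inter> b)" "p \<in> P"
  shows "Fin (\<lambda>n. n \<^bold>\<in> check a \<^bold>\<and> n \<^bold>\<in> check b) p"
proof (rule Fin_if_not_Infin_below[OF assms(2)])
  show "\<not> Infin (\<lambda>n. n \<^bold>\<in> check a \<^bold>\<and> n \<^bold>\<in> check b) q" if "q \<in> P" for q
    using Infin_ground[of q "\<lambda>n. n \<^bold>\<in> check a \<^bold>\<and> n \<^bold>\<in> check b" "a \<inter> b"] that assms(1)
    by (simp add: Conj_iff)
qed simp

lemma AD_check_family:
  assumes A: "almost_disjoint_family A" and p: "p \<in> P"
  shows "AD_family (check_family A) p"
proof (rule AD_familyI[OF p])
  show "(\<^bold>\<not> FinF (check_family A)) p"
    using A by (intro not_FinF_if_infinite[of A] check_MemF_check_family)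
      (auto simp: almost_disjoint_family_def)
  show "Infin (\<lambda>n. n \<^bold>\<in> \<pi>) q" if "(\<pi>, u) \<in> check_family A" "q \<in> P" for \<pi> u q
    using that(1) A Infin_check[OF _ that(2)]
    unfolding check_family_def almost_disjoint_family_def by blast
  show "Fin (\<lambda>n. n \<^bold>\<in> \<pi> \<^bold>\<and> n \<^bold>\<in> \<pi>') q"
    if mem: "(\<pi>, u) \<in> check_family A" "(\<pi>', u') \<in> check_family A"
      and q: "q \<in> P" and ne: "(\<^bold>\<not> \<pi> \<^bold>= \<pi>') q" for \<pi> u \<pi>' u' q
  proof -
    obtain a b where ab: "a \<in> A" "b \<in> A" "\<pi> = check a" "\<pi>' = check b"
      using mem by (auto simp: check_family_def)
    have "a \<noteq> b" using ne Eq_refl[OF q] le_refl[OF q] q by (auto simp: ab Neg_iff)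
    then have "finite (a \<inter> b)"
      using A ab unfolding almost_disjoint_family_def by blast
    then show ?thesis unfolding ab using q by (rule Fin_check_Int)
  qed
qed (use one_in in \<open>auto simp: check_family_def\<close>)

text \<open>
  The density form of maximality: no infinite real of the extension is almost disjoint from all of \<open>A\<close>.
\<close>
definition every_real_meets :: "nat set set \<Rightarrow> bool" where
  "every_real_meets A \<longleftrightarrow>
     (\<forall>\<sigma>\<in>real_names. \<forall>p\<in>P. Infin (\<lambda>n. n \<^bold>\<in> \<sigma>) p \<longrightarrow>
        (\<exists>q\<in>P. q \<preceq> p \<and> (\<exists>a\<in>A. Infin (\<lambda>n. n \<^bold>\<in> \<sigma> \<^bold>\<and> n \<^bold>\<in> check a) q)))"

text \<open>
  If \<open>p\<close> forces \<open>\<sigma>\<close> to be infinite and almost disjoint from every element of \<open>A\<close>, then below \<open>p\<close>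
  the family \<open>A \<union> {\<sigma>}\<close> refutes maximality.
\<close>
lemma every_real_meets_if_MAD:
  assumes A: "almost_disjoint_family A" and MAD: "\<And>p. p \<in> P \<Longrightarrow> MAD (check_family A) p"
  shows "every_real_meets A"
  unfolding every_real_meets_def
proof (intro ballI impI, rule ccontr)
  fix \<sigma> p
  assume \<sigma>: "\<sigma> \<in> real_names" and p: "p \<in> P" and inf: "Infin (\<lambda>n. n \<^bold>\<in> \<sigma>) p"
    and no: "\<not> (\<exists>q\<in>P. q \<preceq> p \<and> (\<exists>a\<in>A. Infin (\<lambda>n. n \<^bold>\<in> \<sigma> \<^bold>\<and> n \<^bold>\<in> check a) q))"
  have inf': "Infin (\<lambda>n. n \<^bold>\<in> \<sigma>) q" if "q \<in> P" "q \<preceq> p" for q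
    using regular_mono[OF regular_Infin p that inf] by simp
  have fin: "Fin (\<lambda>n. n \<^bold>\<in> \<sigma> \<^bold>\<and> n \<^bold>\<in> check a) q" if "a \<in> A" "q \<in> P" "q \<preceq> p" for a q
  proof (rule Fin_if_not_Infin_below[OF that(2)])
    show "\<not> Infin (\<lambda>n. n \<^bold>\<in> \<sigma> \<^bold>\<and> n \<^bold>\<in> check a) r" if "r \<in> P" "r \<preceq> q" for r
      using no le_trans[OF that(1) \<open>q \<in> P\<close> p that(2) \<open>q \<preceq> p\<close>] that(1) \<open>a \<in> A\<close> by blast
  qed simp
  have fin': "Fin (\<lambda>n. n \<^bold>\<in> check a \<^bold>\<and> n \<^bold>\<in> \<sigma>) q" if "a \<in> A" "q \<in> P" "q \<preceq> p" for a q
    by (rule Fin_mono[OF fin[OF that] that(2)]) (auto simp: Conj_iff)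
  \<comment> \<open>Attaching the condition \<open>p\<close> to \<open>\<sigma>\<close> makes \<open>\<B>\<close> name \<open>A\<close> alone when \<open>p\<close> is not in the generic filter.\<close>
  define \<B> where "\<B> = insert (\<sigma>, p) (check_family A)"
  have \<B>: "\<B> \<in> family_names"
    using check_family_in_family_names[of A] \<sigma> p by (auto simp: \<B>_def family_names_def)
  have sub: "check_family A \<subseteq> \<B>" by (auto simp: \<B>_def)
  have AD: "AD_family \<B> p"
  proof (rule AD_familyI[OF p])
    show "(\<^bold>\<not> FinF \<B>) p"
    proof (rule not_FinF_if_infinite)
      show "infinite A" using A by (simp add: almost_disjoint_family_def)
      show "(check a \<^bold>\<in>\<^sub>F \<B>) q" if "a \<in> A" "q \<in> P" for a q
        using MemF_mono[OF check_MemF_check_family[OF that] sub] .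
    qed
    show "Infin (\<lambda>n. n \<^bold>\<in> \<pi>) q" if "(\<pi>, u) \<in> \<B>" "q \<in> P" "q \<preceq> p" for \<pi> u q
      using that(1) A Infin_check[OF _ that(2)] inf'[OF that(2,3)]
      unfolding \<B>_def check_family_def almost_disjoint_family_def by blast
    show "Fin (\<lambda>n. n \<^bold>\<in> \<pi> \<^bold>\<and> n \<^bold>\<in> \<pi>') q"
      if mem: "(\<pi>, u) \<in> \<B>" "(\<pi>', u') \<in> \<B>" and q: "q \<in> P" "q \<preceq> p" and ne: "(\<^bold>\<not> \<pi> \<^bold>= \<pi>') q"
      for \<pi> u \<pi>' u' q
    proof -
      have ne': "\<pi> \<noteq> \<pi>'" using ne Eq_refl[OF q(1)] le_refl[OF q(1)] q by (auto simp: Neg_iff)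
      consider a b where "a \<in> A" "b \<in> A" "\<pi> = check a" "\<pi>' = check b"
        | a where "a \<in> A" "\<pi> = \<sigma>" "\<pi>' = check a" | a where "a \<in> A" "\<pi> = check a" "\<pi>' = \<sigma>"
        using mem ne' by (auto simp: \<B>_def check_family_def)
      then show ?thesis
      proof cases
        case 1
        have "a \<noteq> b" using 1(3,4) ne' by auto
        then have "finite (a \<inter> b)"
          using A 1(1,2) unfolding almost_disjoint_family_def by simp
        then show ?thesis unfolding 1 using q(1) by (rule Fin_check_Int)
      qed (use fin fin' q in auto)
    qed
  qed (use one_in p in \<open>auto simp: \<B>_def check_family_def\<close>)
  have SubF: "(check_family A \<^bold>\<subseteq>\<^sub>F \<B>) p"
    unfolding SubF_def using p MemF_mono[OF _ sub] by (simp add: Forall_iff Impl_iff)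
  have neq: "(\<^bold>\<not> check_family A \<^bold>=\<^sub>F \<B>) p"
    unfolding Neg_iff
  proof (intro ballI impI notI)
    fix q assume q: "q \<in> P" "q \<preceq> p" and eq: "(check_family A \<^bold>=\<^sub>F \<B>) q"
    have "(\<sigma> \<^bold>\<in>\<^sub>F \<B>) q"
      by (rule MemFI[of \<sigma> p]) (use p q Eq_refl in \<open>auto simp: \<B>_def\<close>)
    then have "(\<sigma> \<^bold>\<in>\<^sub>F check_family A) q"
      using eq q(1) \<sigma> le_refl unfolding EqF_def by (auto simp: Forall_iff Iff_iff)
    then obtain r a where r: "r \<in> P" "r \<preceq> q" "a \<in> A" "(\<sigma> \<^bold>= check a) r"
      using q(1) le_refl[OF q(1)] unfolding MemF_check_family by blast
    have rp: "r \<preceq> p" using le_trans[OF r(1) q(1) p r(2) q(2)] .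
    have "Infin (\<lambda>n. n \<^bold>\<in> \<sigma> \<^bold>\<and> n \<^bold>\<in> check a) r"
      by (rule Infin_mono[OF inf'[OF r(1) rp] r(1)]) (use r in \<open>auto simp: Eq_iff Conj_iff\<close>)
    then show False using no r rp by blast
  qed
  have "(\<^bold>\<exists>\<^sub>F\<B>. AD_family \<B> \<^bold>\<and> check_family A \<^bold>\<subseteq>\<^sub>F \<B> \<^bold>\<and> (\<^bold>\<not> check_family A \<^bold>=\<^sub>F \<B>)) p"
    using \<B> AD SubF neq p by (intro ExistsI[of p \<B>]) (auto simp: Conj_iff)
  then show False
    using MAD[OF p] p le_refl unfolding MAD_def by (auto simp: Conj_iff Neg_iff)
qed

text \<open>
  A larger almost disjoint family \<open>\<B>\<close> has an element \<open>x\<close> outside \<open>A\<close>, which is infinite. By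
  assumption some \<open>a \<in> A\<close> meets it in an infinite set, although \<open>x\<close> and \<open>a\<close> are distinct elements of \<open>\<B>\<close>.
\<close>
lemma MAD_if_every_real_meets:
  assumes A: "almost_disjoint_family A" and meets: "every_real_meets A" and p: "p \<in> P"
  shows "MAD (check_family A) p"
proof -
  have "\<not> (\<^bold>\<exists>\<^sub>F\<B>. AD_family \<B> \<^bold>\<and> check_family A \<^bold>\<subseteq>\<^sub>F \<B> \<^bold>\<and> (\<^bold>\<not> check_family A \<^bold>=\<^sub>F \<B>)) q"
    if q: "q \<in> P" for q
  proof
    assume "(\<^bold>\<exists>\<^sub>F\<B>. AD_family \<B> \<^bold>\<and> check_family A \<^bold>\<subseteq>\<^sub>F \<B> \<^bold>\<and> (\<^bold>\<not> check_family A \<^bold>=\<^sub>F \<B>)) q"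
    from ExistsD[OF this q] obtain r \<B> where r: "r \<in> P" "AD_family \<B> r"
      "(check_family A \<^bold>\<subseteq>\<^sub>F \<B>) r" "(\<^bold>\<not> check_family A \<^bold>=\<^sub>F \<B>) r"
      by (auto simp: Conj_iff)
    have sub: "(x \<^bold>\<in>\<^sub>F \<B>) t" if "x \<in> real_names" "t \<in> P" "t \<preceq> r" "(x \<^bold>\<in>\<^sub>F check_family A) t" for x t
      using r(1,3) that unfolding SubF_def by (simp add: Forall_iff Impl_iff)
    have "\<not> (check_family A \<^bold>=\<^sub>F \<B>) r" using r(1,4) le_refl by (simp add: Neg_iff)
    then obtain x t where x: "x \<in> real_names" and t: "t \<in> P" "t \<preceq> r"
      and xt: "(x \<^bold>\<in>\<^sub>F \<B>) t" "\<not> (x \<^bold>\<in>\<^sub>F check_family A) t"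
      using r(1) sub unfolding EqF_def by (auto simp: Forall_iff Iff_iff)
    obtain u where u: "u \<in> P" "u \<preceq> t" "(\<^bold>\<not> x \<^bold>\<in>\<^sub>F check_family A) u"
      using ex_Neg_if_not[OF regular_MemF t(1) xt(2)] by blast
    have ur: "u \<preceq> r" using u t r le_trans by blast
    have xu: "(x \<^bold>\<in>\<^sub>F \<B>) u" using regular_mono[OF regular_MemF t(1) u(1,2) xt(1)] .
    have "Infin (\<lambda>n. n \<^bold>\<in> x) u" using AD_family_Infin[OF r(2,1) x u(1) ur xu] .
    then obtain v a where v: "v \<in> P" "v \<preceq> u" "a \<in> A"
      "Infin (\<lambda>n. n \<^bold>\<in> x \<^bold>\<and> n \<^bold>\<in> check a) v"
      using meets x u(1) unfolding every_real_meets_def by blast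
    have vr: "v \<preceq> r" using v u ur r le_trans by blast
    have xv: "(x \<^bold>\<in>\<^sub>F \<B>) v" using regular_mono[OF regular_MemF u(1) v(1,2) xu] .
    have av: "(check a \<^bold>\<in>\<^sub>F \<B>) v"
      using sub[OF check_in_real_names v(1) vr check_MemF_check_family[OF v(3,1)]] .
    have ne: "(\<^bold>\<not> x \<^bold>= check a) v"
      unfolding Neg_iff
    proof (intro ballI impI notI)
      fix w assume w: "w \<in> P" "w \<preceq> v" "(x \<^bold>= check a) w"
      then have "(x \<^bold>\<in>\<^sub>F check_family A) w"
        using MemF_Eq[OF w(1) Eq_sym[OF w(1,3)]] check_MemF_check_family v(3) by blast
      moreover have "w \<preceq> u" using w v u le_trans by blast
      ultimately show False using u(3) w(1) by (auto simp: Neg_iff)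
    qed
    have "Fin (\<lambda>n. n \<^bold>\<in> x \<^bold>\<and> n \<^bold>\<in> check a) v"
      using AD_family_Fin[OF r(2,1) x check_in_real_names v(1) vr xv av ne] .
    then show False using Infin_not_Fin v(1,4) by blast
  qed
  then show ?thesis
    using AD_check_family[OF A p] unfolding MAD_def by (simp add: Conj_iff Neg_iff)
qed

section \<open>Fin-intersecting families in the extension\<close>

definition trace :: "(nat \<Rightarrow> 'p real_name) \<Rightarrow> 'p real_name \<Rightarrow> 'p real_name \<Rightarrow> nat \<Rightarrow> 'p sentence" where
  "trace C I a n = (n \<^bold>\<in> I \<^bold>\<and> (\<^bold>\<exists>\<^sub>\<omega>k. k \<^bold>\<in> a \<^bold>\<and> k \<^bold>\<in> C n))"

lemma regular_trace [simp]: "regular (trace C I a n)"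
  unfolding trace_def by simp

lemma trace_Eq:
  assumes "(a \<^bold>= b) p" "p \<in> P"
  shows "trace C I a n p \<longleftrightarrow> trace C I b n p"
proof -
  have "(k \<^bold>\<in> a) r \<longleftrightarrow> (k \<^bold>\<in> b) r" if "r \<in> P" "r \<preceq> q" "q \<in> P" "q \<preceq> p" for k r q
    using assms le_trans[OF that(1,3) assms(2) that(2,4)] that(1) by (simp add: Eq_iff)
  then have "(\<exists>r\<in>P. r \<preceq> q \<and> (\<exists>k. (k \<^bold>\<in> a) r \<and> (k \<^bold>\<in> C n) r)) \<longleftrightarrow>
      (\<exists>r\<in>P. r \<preceq> q \<and> (\<exists>k. (k \<^bold>\<in> b) r \<and> (k \<^bold>\<in> C n) r))" if "q \<in> P" "q \<preceq> p" for q
    using that by (intro bex_cong conj_cong ex_cong1 refl) auto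
  then show ?thesis
    unfolding trace_def by (simp add: Conj_iff Exists_iff)
qed

text \<open>
  The density form of being fin-intersecting. The finite subfamilies of the traces are represented by
  the finite sets \<open>F\<close> of those \<open>a \<in> A\<close> that they come from; such an \<open>F\<close> lies in the ground model.
\<close>
definition centers_fin_sequences :: "nat set set \<Rightarrow> bool" where
  "centers_fin_sequences A \<longleftrightarrow>
     (\<forall>C\<in>sequence_names. \<forall>p\<in>P. fin_sequence C p \<longrightarrow>
        (\<exists>q\<in>P. q \<preceq> p \<and> (\<exists>I\<in>real_names. Infin (\<lambda>n. n \<^bold>\<in> I) q \<and>
          (\<forall>F. finite F \<longrightarrow> F \<noteq> {} \<longrightarrow> F \<subseteq> A \<longrightarrow>
            (\<forall>r\<in>P. r \<preceq> q \<longrightarrow> (\<forall>a\<in>F. Infin (trace C I (check a)) r) \<longrightarrow>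
              Infin (\<lambda>n. Forall F (\<lambda>a. trace C I (check a) n)) r)))))"

text \<open>
  Centeredness is applied to the name \<open>\<F>\<close> for the family of the traces of the elements of \<open>F\<close>.
\<close>
lemma centered_traces_ground:
  assumes centered: "centered (traces (check_family A) C I) q" and q: "q \<in> P"
    and F: "finite F" "F \<noteq> {}" "F \<subseteq> A"
    and r: "r \<in> P" "r \<preceq> q" "\<And>a. a \<in> F \<Longrightarrow> Infin (trace C I (check a)) r"
  shows "Infin (\<lambda>n. Forall F (\<lambda>a. trace C I (check a) n)) r"
proof -
  define \<tau> where "\<tau> a = name_of (trace C I (check a))" for a
  have Mem_\<tau>: "(n \<^bold>\<in> \<tau> a) p \<longleftrightarrow> trace C I (check a) n p" if "p \<in> P" for n a p
    unfolding \<tau>_def using that by (simp add: Mem_name_of)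
  define \<F> where "\<F> = \<tau> ` F \<times> {\<one>}"
  have \<tau>: "\<tau> a \<in> real_names" for a by (simp add: \<tau>_def)
  then have \<F>: "\<F> \<in> family_names" using one_in by (auto simp: \<F>_def family_names_def)
  have \<tau>_in: "(\<tau> a \<^bold>\<in>\<^sub>F \<F>) t" if "a \<in> F" "t \<in> P" for a t
    by (rule MemFI[of "\<tau> a" \<one>])
      (use that in \<open>auto simp: \<F>_def one_in le_one Eq_refl\<close>)
  have "traces (check_family A) C I x t"
    if t: "t \<in> P" "t \<preceq> r" and x: "(x \<^bold>\<in>\<^sub>F \<F>) t" for x t
  proof (rule regular_dense[OF regular_traces t(1)])
    fix u assume u: "u \<in> P" "u \<preceq> t"
    then obtain v a where v: "v \<in> P" "v \<preceq> u" "a \<in> F" "(x \<^bold>= \<tau> a) v"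
      using x unfolding MemF_iff \<F>_def by blast
    have vr: "v \<preceq> r" using le_trans[OF v(1) u(1) r(1) v(2) le_trans[OF u(1) t(1) r(1) u(2) t(2)]] .
    have x_iff: "(n \<^bold>\<in> x) w \<longleftrightarrow> trace C I (check a) n w" if "w \<in> P" "w \<preceq> v" for n w
      using v(1,4) that Mem_\<tau>[OF that(1)] by (simp add: Eq_iff)
    have "(\<^bold>\<forall>\<^sub>\<omega>n. n \<^bold>\<in> x \<^bold>\<longleftrightarrow> trace C I (check a) n) v"
      using x_iff v(1) by (simp add: Forall_iff Iff_iff)
    then have 1: "(\<^bold>\<exists>\<^sub>ra. a \<^bold>\<in>\<^sub>F check_family A \<^bold>\<and>
        (\<^bold>\<forall>\<^sub>\<omega>n. n \<^bold>\<in> x \<^bold>\<longleftrightarrow> n \<^bold>\<in> I \<^bold>\<and> (\<^bold>\<exists>\<^sub>\<omega>k. k \<^bold>\<in> a \<^bold>\<and> k \<^bold>\<in> C n))) v"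
      using check_MemF_check_family[of a A v] F(3) v(1,3)
      by (intro ExistsI[OF v(1), of "check a"]) (auto simp: Conj_iff trace_def)
    have 2: "\<not> Fin (\<lambda>n. n \<^bold>\<in> x) w" if w: "w \<in> P" "w \<preceq> v" for w
    proof -
      have "Infin (trace C I (check a)) w"
        by (rule regular_mono[OF regular_Infin r(1) w(1) _ r(3)[OF v(3)]])
          (use le_trans[OF w(1) v(1) r(1) w(2) vr] in simp_all)
      then have "Infin (\<lambda>n. n \<^bold>\<in> x) w"
        by (rule Infin_mono) (use w x_iff le_trans[OF _ w(1) v(1) _ w(2)] in auto)
      then show ?thesis using Infin_not_Fin w(1) by blast
    qed
    have "traces (check_family A) C I x v"
      unfolding traces_def using 1 2 by (simp add: Conj_iff Neg_iff)
    then show "\<exists>v\<in>P. v \<preceq> u \<and> traces (check_family A) C I x v" using v(1,2) by blast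
  qed
  then have "(\<^bold>\<forall>\<^sub>rx. x \<^bold>\<in>\<^sub>F \<F> \<^bold>\<longrightarrow> traces (check_family A) C I x) r"
    using r(1) by (simp add: Forall_iff Impl_iff)
  moreover have "FinF \<F> r"
    unfolding \<F>_def using F(1) \<tau> r(1) by (rule FinF_image)
  moreover have "(\<^bold>\<exists>\<^sub>rx. x \<^bold>\<in>\<^sub>F \<F>) r"
  proof -
    obtain a where "a \<in> F" using F(2) by blast
    then show ?thesis by (intro ExistsI[OF r(1) \<tau>] \<tau>_in r(1)) simp_all
  qed
  ultimately have "Infin (\<lambda>k. \<^bold>\<forall>\<^sub>rx. x \<^bold>\<in>\<^sub>F \<F> \<^bold>\<longrightarrow> k \<^bold>\<in> x) r"
    using centered q r(1,2) \<F> unfolding centered_def by (simp add: Forall_iff Impl_iff Conj_iff)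
  then show ?thesis
  proof (rule Infin_mono[OF _ r(1)])
    fix k t assume t: "t \<in> P" and all: "(\<^bold>\<forall>\<^sub>rx. x \<^bold>\<in>\<^sub>F \<F> \<^bold>\<longrightarrow> k \<^bold>\<in> x) t"
    have "trace C I (check a) k t" if "a \<in> F" for a
    proof -
      have "(k \<^bold>\<in> \<tau> a) t"
        using all t \<tau>_in[OF that t] \<tau> le_refl[OF t] by (simp add: Forall_iff Impl_iff)
      then show ?thesis using Mem_\<tau>[OF t] by simp
    qed
    then show "Forall F (\<lambda>a. trace C I (check a) k) t" by (simp add: Forall_iff)
  qed simp_all
qed

lemma centers_fin_sequences_if_fin_intersecting:
  assumes "\<And>p. p \<in> P \<Longrightarrow> fin_intersecting (check_family A) p"
  shows "centers_fin_sequences A"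
  unfolding centers_fin_sequences_def
proof (intro ballI impI)
  fix C p assume C: "C \<in> sequence_names" and p: "p \<in> P" and fs: "fin_sequence C p"
  have "(\<^bold>\<exists>\<^sub>rI. Infin (\<lambda>n. n \<^bold>\<in> I) \<^bold>\<and> centered (traces (check_family A) C I)) p"
    using assms[OF p] C p fs le_refl[OF p] unfolding fin_intersecting_def
    by (simp add: Conj_iff Forall_iff Impl_iff)
  from ExistsD[OF this p] obtain q I where q: "q \<in> P" "q \<preceq> p" "I \<in> real_names"
    "Infin (\<lambda>n. n \<^bold>\<in> I) q" "centered (traces (check_family A) C I) q"
    by (auto simp: Conj_iff)
  show "\<exists>q\<in>P. q \<preceq> p \<and> (\<exists>I\<in>real_names. Infin (\<lambda>n. n \<^bold>\<in> I) q \<and>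
      (\<forall>F. finite F \<longrightarrow> F \<noteq> {} \<longrightarrow> F \<subseteq> A \<longrightarrow>
        (\<forall>r\<in>P. r \<preceq> q \<longrightarrow> (\<forall>a\<in>F. Infin (trace C I (check a)) r) \<longrightarrow>
          Infin (\<lambda>n. Forall F (\<lambda>a. trace C I (check a) n)) r)))"
    by (intro bexI[of _ q] bexI[of _ I] conjI allI impI ballI q
        centered_traces_ground[OF q(5,1)]) auto
qed

text \<open>
  Conversely, given a name \<open>\<F>\<close> for a finite nonempty family of infinite traces, densely many conditions
  fix an enumeration \<open>s 0, \<dots>, s (n - 1)\<close> of it and, by \<open>finite_dense\<close>, elements \<open>f i\<close> of \<open>A\<close> such
  that \<open>s i\<close> is the trace of \<open>f i\<close>. The assumption then applies to \<open>F = f ` {..<n}\<close>.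
\<close>
lemma centered_tracesI:
  assumes q: "q \<in> P"
    and ground: "\<And>F r. finite F \<Longrightarrow> F \<noteq> {} \<Longrightarrow> F \<subseteq> A \<Longrightarrow> r \<in> P \<Longrightarrow> r \<preceq> q \<Longrightarrow>
      (\<And>a. a \<in> F \<Longrightarrow> Infin (trace C I (check a)) r) \<Longrightarrow>
      Infin (\<lambda>n. Forall F (\<lambda>a. trace C I (check a) n)) r"
  shows "centered (traces (check_family A) C I) q"
proof -
  have "Infin (\<lambda>k. \<^bold>\<forall>\<^sub>rx. x \<^bold>\<in>\<^sub>F \<F> \<^bold>\<longrightarrow> k \<^bold>\<in> x) p"
    if p: "p \<in> P" "p \<preceq> q"
      and tr: "\<And>x t. x \<in> real_names \<Longrightarrow> t \<in> P \<Longrightarrow> t \<preceq> p \<Longrightarrow> (x \<^bold>\<in>\<^sub>F \<F>) t \<Longrightarrow> traces (check_family A) C I x t"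
      and fin: "FinF \<F> p" and ne: "(\<^bold>\<exists>\<^sub>rx. x \<^bold>\<in>\<^sub>F \<F>) p" for \<F> p
  proof (rule regular_dense[OF _ p(1)])
    fix p' assume p': "p' \<in> P" "p' \<preceq> p"
    have "FinF \<F> p'" using regular_mono[OF regular_FinF p(1) p' fin] .
    from this p'(1) obtain u n s where u: "u \<in> P" "u \<preceq> p'" "s \<in> sequence_names"
      and eq: "\<And>x t. x \<in> real_names \<Longrightarrow> t \<in> P \<Longrightarrow> t \<preceq> u \<Longrightarrow>
         (x \<^bold>\<in>\<^sub>F \<F>) t \<longleftrightarrow> Exists {..<n} (\<lambda>i. x \<^bold>= s i) t"
      by (rule FinF_E) blast
    have up: "u \<preceq> p" using le_trans[OF u(1) p'(1) p(1) u(2) p'(2)] .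
    have s: "s i \<in> real_names" for i using u(3) by (simp add: sequence_names_def)
    have "(\<^bold>\<exists>\<^sub>rx. x \<^bold>\<in>\<^sub>F \<F>) u"
      using regular_mono[of "\<^bold>\<exists>\<^sub>rx. x \<^bold>\<in>\<^sub>F \<F>", OF _ p(1) u(1) up] ne by simp
    from ExistsD[OF this u(1)] obtain w x where w: "w \<in> P" "w \<preceq> u" "x \<in> real_names" "(x \<^bold>\<in>\<^sub>F \<F>) w"
      by blast
    then have "Exists {..<n} (\<lambda>i. x \<^bold>= s i) w" using eq by blast
    \<comment> \<open>Nonemptiness of the family makes \<open>f ` {..<n}\<close> nonempty below.\<close>
    from ExistsD[OF this w(1)] have n: "0 < n" by auto
    \<comment> \<open>The requirement that the ground model element of \<open>A\<close> with trace \<open>s i\<close> is decided.\<close>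
    define D where "D i t \<longleftrightarrow> (\<exists>a\<in>A. (\<^bold>\<forall>\<^sub>\<omega>n. n \<^bold>\<in> s i \<^bold>\<longleftrightarrow> trace C I (check a) n) t)" for i t
    have traces: "traces (check_family A) C I (s i) t" if t: "t \<in> P" "t \<preceq> u" and i: "i < n" for i t
    proof (rule tr[OF s t(1)])
      show "t \<preceq> p" using le_trans[OF t(1) u(1) p(1) t(2) up] .
      have "Exists {..<n} (\<lambda>j. s i \<^bold>= s j) t"
        using i Eq_refl[OF t(1)] by (intro ExistsI[OF t(1), of i]) simp_all
      then show "(s i \<^bold>\<in>\<^sub>F \<F>) t" using eq[OF s t] by simp
    qed
    have "\<exists>v\<in>P. v \<preceq> u \<and> (\<forall>i\<in>{..<n}. D i v)"
    proof (rule finite_dense[OF _ u(1)])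
      show "D i r" if qr: "q \<in> P" "r \<in> P" "r \<preceq> q" and Dq: "D i q" for i q r
      proof -
        obtain a where "a \<in> A" "(\<^bold>\<forall>\<^sub>\<omega>n. n \<^bold>\<in> s i \<^bold>\<longleftrightarrow> trace C I (check a) n) q"
          using Dq unfolding D_def by blast
        moreover from this(2) have "(\<^bold>\<forall>\<^sub>\<omega>n. n \<^bold>\<in> s i \<^bold>\<longleftrightarrow> trace C I (check a) n) r"
          using regular_mono[of "\<^bold>\<forall>\<^sub>\<omega>n. n \<^bold>\<in> s i \<^bold>\<longleftrightarrow> trace C I (check a) n", OF _ qr]
          by simp
        ultimately show ?thesis unfolding D_def by blast
      qed
      show "\<exists>v\<in>P. v \<preceq> t \<and> D i v" if "i \<in> {..<n}" and t: "t \<in> P" "t \<preceq> u" for i t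
      proof -
        have "i < n" using that(1) by simp
        from traces[OF t this]
        have "(\<^bold>\<exists>\<^sub>ra. a \<^bold>\<in>\<^sub>F check_family A \<^bold>\<and> (\<^bold>\<forall>\<^sub>\<omega>n. n \<^bold>\<in> s i \<^bold>\<longleftrightarrow> trace C I a n)) t"
          unfolding traces_def trace_def by (simp add: Conj_iff)
        from ExistsD[OF this t(1)] obtain w a where w: "w \<in> P" "w \<preceq> t"
          and aA: "(a \<^bold>\<in>\<^sub>F check_family A) w"
          and a: "(\<^bold>\<forall>\<^sub>\<omega>n. n \<^bold>\<in> s i \<^bold>\<longleftrightarrow> trace C I a n) w"
          by (auto simp: Conj_iff)
        obtain v b where v: "v \<in> P" "v \<preceq> w" "b \<in> A" "(a \<^bold>= check b) v"
          using aA w(1) le_refl[OF w(1)] unfolding MemF_check_family by blast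
        have "(m \<^bold>\<in> s i) z \<longleftrightarrow> trace C I (check b) m z" if z: "z \<in> P" "z \<preceq> v" for m z
        proof -
          have "(m \<^bold>\<in> s i) z \<longleftrightarrow> trace C I a m z"
            using a w(1) z(1) le_trans[OF z(1) v(1) w(1) z(2) v(2)]
            by (simp add: Forall_iff Iff_iff)
          also have "\<dots> \<longleftrightarrow> trace C I (check b) m z"
            using trace_Eq[OF regular_mono[OF regular_Eq v(1) z v(4)] z(1)] .
          finally show ?thesis .
        qed
        then have "(\<^bold>\<forall>\<^sub>\<omega>n. n \<^bold>\<in> s i \<^bold>\<longleftrightarrow> trace C I (check b) n) v"
          using v(1) by (simp add: Forall_iff Iff_iff)
        then have "D i v" unfolding D_def using v(3) by blast
        then show ?thesis using v(1) le_trans[OF v(1) w(1) t(1) v(2) w(2)] by blast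
      qed
    qed simp
    then obtain v where v: "v \<in> P" "v \<preceq> u" "\<forall>i\<in>{..<n}. D i v" by blast
    then have "\<forall>i\<in>{..<n}. \<exists>a. a \<in> A \<and> (\<^bold>\<forall>\<^sub>\<omega>n. n \<^bold>\<in> s i \<^bold>\<longleftrightarrow> trace C I (check a) n) v"
      unfolding D_def by blast
    from bchoice[OF this] obtain f where f: "\<And>i. i < n \<Longrightarrow> f i \<in> A"
      "\<And>i. i < n \<Longrightarrow> (\<^bold>\<forall>\<^sub>\<omega>n. n \<^bold>\<in> s i \<^bold>\<longleftrightarrow> trace C I (check (f i)) n) v"
      by auto
    have s_iff: "(m \<^bold>\<in> s i) z \<longleftrightarrow> trace C I (check (f i)) m z"
      if "i < n" "z \<in> P" "z \<preceq> v" for i m z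
      using f(2)[OF that(1)] that(2,3) v(1) by (simp add: Forall_iff Iff_iff)
    have inf: "Infin (trace C I (check (f i))) v" if i: "i < n" for i
    proof -
      have "(\<^bold>\<forall>\<^sub>\<omega>m. m \<^bold>\<in> s i \<^bold>\<longrightarrow> m \<^bold>\<in> I) z" if z: "z \<in> P" "z \<preceq> v" for z
        using s_iff[OF i _ le_trans[OF _ z(1) v(1) _ z(2)]] z(1)
        by (simp add: Forall_iff Impl_iff trace_def Conj_iff)
      then have "Infin (\<lambda>m. m \<^bold>\<in> s i) v"
        using traces[OF v(1,2) i] unfolding traces_def
        by (intro Infin_if_not_Fin_below) (auto simp: Conj_iff Neg_iff)
      then show ?thesis
        by (rule Infin_mono) (use v(1) s_iff[OF i] in auto)
    qed
    have vq: "v \<preceq> q"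
      using le_trans[OF v(1) u(1) q v(2) le_trans[OF u(1) p(1) q up p(2)]] .
    have "Infin (\<lambda>k. Forall (f ` {..<n}) (\<lambda>a. trace C I (check a) k)) v"
      by (rule ground) (use f(1) n v(1) vq inf in auto)
    then have "Infin (\<lambda>k. \<^bold>\<forall>\<^sub>rx. x \<^bold>\<in>\<^sub>F \<F> \<^bold>\<longrightarrow> k \<^bold>\<in> x) v"
    proof (rule Infin_mono[OF _ v(1)])
      fix k z assume z: "z \<in> P" "z \<preceq> v"
        and all: "Forall (f ` {..<n}) (\<lambda>a. trace C I (check a) k) z"
      have "(k \<^bold>\<in> x) y" if x: "x \<in> real_names" and y: "y \<in> P" "y \<preceq> z" and mem: "(x \<^bold>\<in>\<^sub>F \<F>) y" for x y
      proof (rule regular_dense[OF regular_Mem y(1)])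
        fix w assume w: "w \<in> P" "w \<preceq> y"
        have wv: "w \<preceq> v" using le_trans[OF w(1) y(1) v(1) w(2) le_trans[OF y(1) z(1) v(1) y(2) z(2)]] .
        have "(x \<^bold>\<in>\<^sub>F \<F>) w" using regular_mono[OF regular_MemF y(1) w mem] .
        then have "Exists {..<n} (\<lambda>i. x \<^bold>= s i) w"
          using eq[OF x w(1) le_trans[OF w(1) v(1) u(1) wv v(2)]] by simp
        from ExistsD[OF this w(1)] obtain w' i where w': "w' \<in> P" "w' \<preceq> w" "i < n" "(x \<^bold>= s i) w'"
          by blast
        have w'z: "w' \<preceq> z"
          using le_trans[OF w'(1) w(1) z(1) w'(2) le_trans[OF w(1) y(1) z(1) w(2) y(2)]] .
        have "trace C I (check (f i)) k w'"
          by (rule regular_mono[OF regular_trace z(1) w'(1) w'z])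
            (use all w'(3) in \<open>simp add: Forall_iff\<close>)
        then have "(k \<^bold>\<in> x) w'"
          using s_iff[OF w'(3,1) le_trans[OF w'(1) z(1) v(1) w'z z(2)]] Mem_Eq[OF w'(1,4)] by simp
        then show "\<exists>w'\<in>P. w' \<preceq> w \<and> (k \<^bold>\<in> x) w'" using w'(1,2) by blast
      qed
      then show "(\<^bold>\<forall>\<^sub>rx. x \<^bold>\<in>\<^sub>F \<F> \<^bold>\<longrightarrow> k \<^bold>\<in> x) z"
        using z(1) by (simp add: Forall_iff Impl_iff)
    qed simp_all
    then show "\<exists>v\<in>P. v \<preceq> p' \<and> Infin (\<lambda>k. \<^bold>\<forall>\<^sub>rx. x \<^bold>\<in>\<^sub>F \<F> \<^bold>\<longrightarrow> k \<^bold>\<in> x) v"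
      using v(1) le_trans[OF v(1) u(1) p'(1) v(2) u(2)] by blast
  qed simp
  then show ?thesis
    using q unfolding centered_def by (simp add: Forall_iff Impl_iff Conj_iff)
qed

lemma fin_intersecting_if_centers_fin_sequences:
  assumes A: "almost_disjoint_family A" and centers: "centers_fin_sequences A" and p: "p \<in> P"
  shows "fin_intersecting (check_family A) p"
proof -
  have "(\<^bold>\<exists>\<^sub>rI. Infin (\<lambda>n. n \<^bold>\<in> I) \<^bold>\<and> centered (traces (check_family A) C I)) q"
    if C: "C \<in> sequence_names" and q: "q \<in> P" and fs: "fin_sequence C q" for C q
    unfolding Exists_iff
  proof (intro ballI impI)
    fix r assume r: "r \<in> P" "r \<preceq> q"
    have "fin_sequence C r" using regular_mono[OF regular_fin_sequence q r fs] .
    then obtain t I where t: "t \<in> P" "t \<preceq> r" "I \<in> real_names" "Infin (\<lambda>n. n \<^bold>\<in> I) t"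
      and ground: "\<forall>F. finite F \<longrightarrow> F \<noteq> {} \<longrightarrow> F \<subseteq> A \<longrightarrow>
        (\<forall>r\<in>P. r \<preceq> t \<longrightarrow> (\<forall>a\<in>F. Infin (trace C I (check a)) r) \<longrightarrow>
          Infin (\<lambda>n. Forall F (\<lambda>a. trace C I (check a) n)) r)"
      using centers C r(1) unfolding centers_fin_sequences_def by blast
    have "centered (traces (check_family A) C I) t"
      by (rule centered_tracesI[OF t(1)]) (use ground in blast)
    then show "\<exists>t\<in>P. t \<preceq> r \<and>
        (\<exists>I\<in>real_names. (Infin (\<lambda>n. n \<^bold>\<in> I) \<^bold>\<and> centered (traces (check_family A) C I)) t)"
      using t by (auto simp: Conj_iff)
  qed
  then show ?thesis
    using AD_check_family[OF A p] p unfolding fin_intersecting_def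
    by (simp add: Conj_iff Forall_iff Impl_iff)
qed

lemma remains_MAD_and_fin_intersecting_iff:
  assumes A: "almost_disjoint_family A"
  shows "remains_MAD_and_fin_intersecting A \<longleftrightarrow> every_real_meets A \<and> centers_fin_sequences A"
proof
  assume "remains_MAD_and_fin_intersecting A"
  then have "MAD (check_family A) p" "fin_intersecting (check_family A) p" if "p \<in> P" for p
    using that by (simp_all add: remains_MAD_and_fin_intersecting_def forced_def Conj_iff)
  then show "every_real_meets A \<and> centers_fin_sequences A"
    using every_real_meets_if_MAD[OF A] centers_fin_sequences_if_fin_intersecting by simp
next
  assume "every_real_meets A \<and> centers_fin_sequences A"
  then show "remains_MAD_and_fin_intersecting A"
    using MAD_if_every_real_meets[OF A] fin_intersecting_if_centers_fin_sequences[OF A]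
    by (simp add: remains_MAD_and_fin_intersecting_def forced_def Conj_iff)
qed

end


section \<open>Projections of forcing notions\<close>

text \<open>
  For a generic filter \<open>G\<close> on \<open>P\<close>, the image of \<open>G\<close> generates a generic filter on \<open>Q\<close>, so the
  extension by \<open>Q\<close> is a submodel of the extension by \<open>P\<close>. The lifting property asks for \<open>\<pi> p' = q\<close>
  rather than only for \<open>\<pi> p'\<close> to extend \<open>q\<close>; this makes pulling back along \<open>\<pi>\<close> commute with
  negation for arbitrary sets of conditions.
\<close>
locale forcing_projection =
  P: forcing_notion P leP oneP + Q: forcing_notion Q leQ oneQ
  for P :: "'p set" and leP oneP and Q :: "'q set" and leQ oneQ +
  fixes \<pi> :: "'p \<Rightarrow> 'q"
  assumes proj_onto: "\<pi> ` P = Q"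
    and proj_mono: "p \<in> P \<Longrightarrow> p' \<in> P \<Longrightarrow> leP p' p \<Longrightarrow> leQ (\<pi> p') (\<pi> p)"
    and proj_lift: "p \<in> P \<Longrightarrow> q \<in> Q \<Longrightarrow> leQ q (\<pi> p) \<Longrightarrow> \<exists>p'\<in>P. leP p' p \<and> \<pi> p' = q"
begin

lemma proj_in: "p \<in> P \<Longrightarrow> \<pi> p \<in> Q"
  using proj_onto by blast

text \<open>
  Pulling back a sentence of the submodel means to evaluate it in the submodel. The lemmas below
  express that arithmetical sentences are absolute between the two extensions.
\<close>
definition pulls_back :: "('p \<Rightarrow> bool) \<Rightarrow> ('q \<Rightarrow> bool) \<Rightarrow> bool" where
  "pulls_back \<phi> \<psi> \<longleftrightarrow> (\<forall>p\<in>P. \<phi> p \<longleftrightarrow> \<psi> (\<pi> p))"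

lemma pulls_backD: "pulls_back \<phi> \<psi> \<Longrightarrow> p \<in> P \<Longrightarrow> \<phi> p \<longleftrightarrow> \<psi> (\<pi> p)"
  by (simp add: pulls_back_def)

lemma pulls_back_Neg:
  assumes "pulls_back \<phi> \<psi>"
  shows "pulls_back (P.Neg \<phi>) (Q.Neg \<psi>)"
  unfolding pulls_back_def
proof
  fix p assume p: "p \<in> P"
  show "P.Neg \<phi> p \<longleftrightarrow> Q.Neg \<psi> (\<pi> p)"
  proof
    assume *: "P.Neg \<phi> p"
    show "Q.Neg \<psi> (\<pi> p)"
      unfolding Q.Neg_iff
    proof (intro ballI impI)
      fix q assume "q \<in> Q" "leQ q (\<pi> p)"
      then obtain p' where p': "p' \<in> P" "leP p' p" "\<pi> p' = q" using proj_lift p by blast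
      then show "\<not> \<psi> q" using * pulls_backD[OF assms p'(1)] by (simp add: P.Neg_iff)
    qed
  next
    assume *: "Q.Neg \<psi> (\<pi> p)"
    show "P.Neg \<phi> p"
      unfolding P.Neg_iff
    proof (intro ballI impI)
      fix p' assume p': "p' \<in> P" "leP p' p"
      then show "\<not> \<phi> p'"
        using * pulls_backD[OF assms p'(1)] proj_in[OF p'(1)] proj_mono[OF p p']
        by (simp add: Q.Neg_iff)
    qed
  qed
qed

lemma pulls_back_Conj:
  "pulls_back \<phi> \<psi> \<Longrightarrow> pulls_back \<phi>' \<psi>' \<Longrightarrow> pulls_back (P.Conj \<phi> \<phi>') (Q.Conj \<psi> \<psi>')"
  by (simp add: pulls_back_def P.Conj_iff Q.Conj_iff)

lemma pulls_back_Forall: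
  "(\<And>x. x \<in> N \<Longrightarrow> pulls_back (\<phi> x) (\<psi> x)) \<Longrightarrow> pulls_back (P.Forall N \<phi>) (Q.Forall N \<psi>)"
  by (simp add: pulls_back_def P.Forall_iff Q.Forall_iff)

lemma pulls_back_Impl:
  "pulls_back \<phi> \<psi> \<Longrightarrow> pulls_back \<phi>' \<psi>' \<Longrightarrow> pulls_back (P.Impl \<phi> \<phi>') (Q.Impl \<psi> \<psi>')"
  unfolding P.Impl_def Q.Impl_def by (intro pulls_back_Neg pulls_back_Conj)

lemma pulls_back_Iff:
  "pulls_back \<phi> \<psi> \<Longrightarrow> pulls_back \<phi>' \<psi>' \<Longrightarrow> pulls_back (P.Iff \<phi> \<phi>') (Q.Iff \<psi> \<psi>')"
  unfolding P.Iff_def Q.Iff_def by (intro pulls_back_Conj pulls_back_Impl)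

lemma pulls_back_Exists:
  "(\<And>x. x \<in> N \<Longrightarrow> pulls_back (\<phi> x) (\<psi> x)) \<Longrightarrow> pulls_back (P.Exists N \<phi>) (Q.Exists N \<psi>)"
  unfolding P.Exists_def Q.Exists_def by (intro pulls_back_Neg pulls_back_Forall)

lemma pulls_back_check: "pulls_back (P.Mem n (P.check a)) (Q.Mem n (Q.check a))"
  by (simp add: pulls_back_def proj_in)

lemmas pulls_back_connectives = pulls_back_Neg pulls_back_Conj pulls_back_Forall
  pulls_back_Impl pulls_back_Iff pulls_back_Exists pulls_back_check

lemma pulls_back_Fin: "(\<And>n. pulls_back (\<phi> n) (\<psi> n)) \<Longrightarrow> pulls_back (P.Fin \<phi>) (Q.Fin \<psi>)"
  unfolding P.Fin_def Q.Fin_def by (intro pulls_back_connectives)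

lemma pulls_back_Infin: "(\<And>n. pulls_back (\<phi> n) (\<psi> n)) \<Longrightarrow> pulls_back (P.Infin \<phi>) (Q.Infin \<psi>)"
  unfolding P.Infin_def Q.Infin_def by (intro pulls_back_Neg pulls_back_Fin)

lemma pulls_back_fin_sequence:
  "(\<And>n k. pulls_back (P.Mem k (C n)) (Q.Mem k (D n))) \<Longrightarrow>
     pulls_back (P.fin_sequence C) (Q.fin_sequence D)"
  unfolding P.fin_sequence_def Q.fin_sequence_def
  by (intro pulls_back_connectives pulls_back_Fin)

lemma pulls_back_trace:
  assumes "\<And>n k. pulls_back (P.Mem k (C n)) (Q.Mem k (D n))"
    and "\<And>n. pulls_back (P.Mem n I) (Q.Mem n J)"
  shows "pulls_back (P.trace C I (P.check a) n) (Q.trace D J (Q.check a) n)"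
  unfolding P.trace_def Q.trace_def by (intro pulls_back_connectives assms)

lemma regular_comp_proj:
  assumes "Q.regular \<psi>"
  shows "P.regular (\<lambda>p. \<psi> (\<pi> p))"
proof (rule P.regularI)
  show "\<psi> (\<pi> p')" if "p \<in> P" "p' \<in> P" "leP p' p" "\<psi> (\<pi> p)" for p p'
    using Q.regular_mono[OF assms proj_in proj_in proj_mono] that by simp
  show "\<psi> (\<pi> p)" if p: "p \<in> P"
    and dense: "\<And>p'. p' \<in> P \<Longrightarrow> leP p' p \<Longrightarrow> \<exists>r\<in>P. leP r p' \<and> \<psi> (\<pi> r)" for p
  proof (rule Q.regular_dense[OF assms proj_in[OF p]])
    fix q assume "q \<in> Q" "leQ q (\<pi> p)"
    then obtain p' where p': "p' \<in> P" "leP p' p" "\<pi> p' = q" using proj_lift p by blast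
    then obtain r where r: "r \<in> P" "leP r p'" "\<psi> (\<pi> r)" using dense by blast
    then show "\<exists>r\<in>Q. leQ r q \<and> \<psi> r"
      using proj_in[OF r(1)] proj_mono[OF p'(1) r(1,2)] p'(3) by blast
  qed
qed

text \<open>
  Every real of the submodel is a real of the large extension, with the name that evaluates membership
  through \<open>\<pi>\<close>.
\<close>
lemma ex_lifted_name: "\<exists>\<sigma>\<in>P.real_names. \<forall>n. pulls_back (P.Mem n \<sigma>) (Q.Mem n \<tau>)"
  using regular_comp_proj
  by (intro bexI[of _ "P.name_of (\<lambda>n p. Q.Mem n \<tau> (\<pi> p))"])
    (simp_all add: pulls_back_def P.Mem_name_of)

text \<open>
  A sentence that does not distinguish conditions with the same projection is the pullback of its image,
  and this image is again a sentence of the forcing language over \<open>Q\<close>.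
\<close>
lemma regular_image_proj:
  assumes reg: "P.regular \<phi>"
    and inv: "\<And>p p'. p \<in> P \<Longrightarrow> p' \<in> P \<Longrightarrow> \<pi> p = \<pi> p' \<Longrightarrow> \<phi> p \<Longrightarrow> \<phi> p'"
  shows "Q.regular (\<lambda>q. \<exists>p\<in>P. \<pi> p = q \<and> \<phi> p)"
proof (rule Q.regularI)
  show "\<exists>p\<in>P. \<pi> p = q' \<and> \<phi> p"
    if q: "q' \<in> Q" "leQ q' q" and ex: "\<exists>p\<in>P. \<pi> p = q \<and> \<phi> p" for q q'
  proof -
    obtain p where p: "p \<in> P" "\<pi> p = q" "\<phi> p" using ex by blast
    then obtain p' where p': "p' \<in> P" "leP p' p" "\<pi> p' = q'" using proj_lift[OF p(1) q(1)] q(2) by blast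
    then show ?thesis using P.regular_mono[OF reg p(1) p'(1,2) p(3)] by blast
  qed
  show "\<exists>p\<in>P. \<pi> p = q \<and> \<phi> p"
    if q: "q \<in> Q" and dense: "\<And>q'. q' \<in> Q \<Longrightarrow> leQ q' q \<Longrightarrow> \<exists>r\<in>Q. leQ r q' \<and> (\<exists>p\<in>P. \<pi> p = r \<and> \<phi> p)" for q
  proof -
    obtain p where p: "p \<in> P" "\<pi> p = q" using q proj_onto by blast
    have "\<phi> p"
    proof (rule P.regular_dense[OF reg p(1)])
      fix p' assume p': "p' \<in> P" "leP p' p"
      then have "leQ (\<pi> p') q" using proj_mono[OF p(1) p'] p(2) by simp
      then obtain z where z: "z \<in> P" "leQ (\<pi> z) (\<pi> p')" "\<phi> z"
        using dense[OF proj_in[OF p'(1)]] by blast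
      obtain r where r: "r \<in> P" "leP r p'" "\<pi> r = \<pi> z"
        using proj_lift[OF p'(1) proj_in[OF z(1)] z(2)] by blast
      then show "\<exists>r\<in>P. leP r p' \<and> \<phi> r" using inv[OF z(1) r(1) _ z(3)] by auto
    qed
    then show ?thesis using p by blast
  qed
qed

text \<open>
  A real of the large extension belongs to the submodel if conditions with the same projection
  force the same natural numbers into it.
\<close>
lemma ex_projected_name:
  assumes "\<And>n p p'. p \<in> P \<Longrightarrow> p' \<in> P \<Longrightarrow> \<pi> p = \<pi> p' \<Longrightarrow> P.Mem n \<sigma> p \<Longrightarrow> P.Mem n \<sigma> p'"
  shows "\<exists>\<tau>\<in>Q.real_names. \<forall>n. pulls_back (P.Mem n \<sigma>) (Q.Mem n \<tau>)"
proof (intro bexI allI)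
  let ?\<psi> = "\<lambda>n q. \<exists>p\<in>P. \<pi> p = q \<and> P.Mem n \<sigma> p"
  show "Q.name_of ?\<psi> \<in> Q.real_names" by simp
  fix n
  have "Q.regular (?\<psi> n)" by (rule regular_image_proj[OF P.regular_Mem]) (rule assms)
  then have "Q.Mem n (Q.name_of ?\<psi>) (\<pi> p) \<longleftrightarrow> ?\<psi> n (\<pi> p)" if "p \<in> P" for p
    using Q.Mem_name_of[of ?\<psi> n "\<pi> p"] proj_in[OF that] by simp
  moreover have "?\<psi> n (\<pi> p) \<longleftrightarrow> P.Mem n \<sigma> p" if "p \<in> P" for p
    using assms[of _ p n] that by auto
  ultimately show "pulls_back (P.Mem n \<sigma>) (Q.Mem n (Q.name_of ?\<psi>))"
    by (simp add: pulls_back_def)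
qed

text \<open>
  The element of \<open>A\<close> with infinite intersection is found in the submodel that contains the real.
\<close>
lemma real_meets_if_every_real_meets_projection:
  assumes meets: "Q.every_real_meets A"
    and inv: "\<And>n p p'. p \<in> P \<Longrightarrow> p' \<in> P \<Longrightarrow> \<pi> p = \<pi> p' \<Longrightarrow> P.Mem n \<sigma> p \<Longrightarrow> P.Mem n \<sigma> p'"
    and p: "p \<in> P" and inf: "P.Infin (\<lambda>n. P.Mem n \<sigma>) p"
  shows "\<exists>q\<in>P. leP q p \<and> (\<exists>a\<in>A. P.Infin (\<lambda>n. P.Conj (P.Mem n \<sigma>) (P.Mem n (P.check a))) q)"
proof -
  have "\<exists>\<tau>\<in>Q.real_names. \<forall>n. pulls_back (P.Mem n \<sigma>) (Q.Mem n \<tau>)"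
    by (rule ex_projected_name) (fact inv)
  then obtain \<tau> where \<tau>: "\<tau> \<in> Q.real_names" "\<And>n. pulls_back (P.Mem n \<sigma>) (Q.Mem n \<tau>)"
    by blast
  have "Q.Infin (\<lambda>n. Q.Mem n \<tau>) (\<pi> p)"
    using inf pulls_backD[OF pulls_back_Infin[OF \<tau>(2)] p] by simp
  then obtain q a where q: "q \<in> Q" "leQ q (\<pi> p)" "a \<in> A"
    and qa: "Q.Infin (\<lambda>n. Q.Conj (Q.Mem n \<tau>) (Q.Mem n (Q.check a))) q"
    using meets \<tau>(1) proj_in[OF p] unfolding Q.every_real_meets_def by blast
  obtain p' where p': "p' \<in> P" "leP p' p" "\<pi> p' = q" using proj_lift[OF p q(1,2)] by blast
  have "pulls_back (P.Infin (\<lambda>n. P.Conj (P.Mem n \<sigma>) (P.Mem n (P.check a))))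
      (Q.Infin (\<lambda>n. Q.Conj (Q.Mem n \<tau>) (Q.Mem n (Q.check a))))"
    by (intro pulls_back_Infin pulls_back_connectives \<tau>)
  from pulls_backD[OF this p'(1)] show ?thesis using qa p' q(3) by blast
qed

text \<open>
  The set \<open>I\<close> is the one found in the submodel that contains \<open>C\<close>. A condition \<open>r\<close> forcing the
  traces to be infinite projects to a condition with the same property, because that is an arithmetical
  sentence; so the conclusion of the submodel about \<open>F\<close> pulls back to \<open>r\<close>.
\<close>
lemma fin_sequence_centered_if_centers_projection:
  assumes centers: "Q.centers_fin_sequences A"
    and inv: "\<And>n k p p'. p \<in> P \<Longrightarrow> p' \<in> P \<Longrightarrow> \<pi> p = \<pi> p' \<Longrightarrow> P.Mem k (C n) p \<Longrightarrow> P.Mem k (C n) p'"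
    and p: "p \<in> P" and fs: "P.fin_sequence C p"
  shows "\<exists>q\<in>P. leP q p \<and> (\<exists>I\<in>P.real_names. P.Infin (\<lambda>n. P.Mem n I) q \<and>
          (\<forall>F. finite F \<longrightarrow> F \<noteq> {} \<longrightarrow> F \<subseteq> A \<longrightarrow>
            (\<forall>r\<in>P. leP r q \<longrightarrow> (\<forall>a\<in>F. P.Infin (P.trace C I (P.check a)) r) \<longrightarrow>
              P.Infin (\<lambda>n. P.Forall F (\<lambda>a. P.trace C I (P.check a) n)) r)))"
proof -
  have "\<exists>\<tau>\<in>Q.real_names. \<forall>k. pulls_back (P.Mem k (C n)) (Q.Mem k \<tau>)" for n
    by (rule ex_projected_name) (fact inv)
  then have "\<forall>n. \<exists>\<tau>. \<tau> \<in> Q.real_names \<and> (\<forall>k. pulls_back (P.Mem k (C n)) (Q.Mem k \<tau>))"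
    by blast
  from choice[OF this] obtain D where D: "\<And>n. D n \<in> Q.real_names"
    "\<And>n k. pulls_back (P.Mem k (C n)) (Q.Mem k (D n))" by blast
  have D_seq: "D \<in> Q.sequence_names" using D(1) by (simp add: Q.sequence_names_def)
  have fs_D: "Q.fin_sequence D (\<pi> p)"
    using fs pulls_backD[OF pulls_back_fin_sequence[OF D(2)] p] by simp
  from centers[unfolded Q.centers_fin_sequences_def, rule_format, OF D_seq proj_in[OF p] fs_D]
  obtain q J where q: "q \<in> Q" "leQ q (\<pi> p)" "Q.Infin (\<lambda>n. Q.Mem n J) q"
    and J: "\<forall>F. finite F \<longrightarrow> F \<noteq> {} \<longrightarrow> F \<subseteq> A \<longrightarrow>
      (\<forall>r\<in>Q. leQ r q \<longrightarrow> (\<forall>a\<in>F. Q.Infin (Q.trace D J (Q.check a)) r) \<longrightarrow>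
        Q.Infin (\<lambda>n. Q.Forall F (\<lambda>a. Q.trace D J (Q.check a) n)) r)"
    by (elim bexE conjE)
  obtain p' where p': "p' \<in> P" "leP p' p" "\<pi> p' = q" using proj_lift[OF p q(1,2)] by blast
  obtain I where I: "I \<in> P.real_names" "\<And>n. pulls_back (P.Mem n I) (Q.Mem n J)"
    using ex_lifted_name by blast
  have inf_I: "P.Infin (\<lambda>n. P.Mem n I) p'"
    using q(3) pulls_backD[OF pulls_back_Infin[OF I(2)] p'(1)] p'(3) by simp
  have "P.Infin (\<lambda>n. P.Forall F (\<lambda>a. P.trace C I (P.check a) n)) r"
    if F: "finite F" "F \<noteq> {}" "F \<subseteq> A" and r: "r \<in> P" "leP r p'"
      and inf: "\<forall>a\<in>F. P.Infin (P.trace C I (P.check a)) r" for F r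
  proof -
    have trace: "pulls_back (P.trace C I (P.check a) n) (Q.trace D J (Q.check a) n)" for a n
      by (rule pulls_back_trace[OF D(2) I(2)])
    have "Q.Infin (\<lambda>n. Q.Forall F (\<lambda>a. Q.trace D J (Q.check a) n)) (\<pi> r)"
    proof (rule J[rule_format, OF F proj_in[OF r(1)]])
      show "leQ (\<pi> r) q" using proj_mono[OF p'(1) r] p'(3) by simp
      show "Q.Infin (Q.trace D J (Q.check a)) (\<pi> r)" if "a \<in> F" for a
        using inf that pulls_backD[OF pulls_back_Infin[OF trace] r(1)] by simp
    qed
    moreover have "pulls_back (P.Infin (\<lambda>n. P.Forall F (\<lambda>a. P.trace C I (P.check a) n)))
        (Q.Infin (\<lambda>n. Q.Forall F (\<lambda>a. Q.trace D J (Q.check a) n)))"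
      by (intro pulls_back_Infin pulls_back_Forall trace)
    ultimately show ?thesis using pulls_backD r(1) by blast
  qed
  then show ?thesis
    by (intro bexI[of _ p'] bexI[of _ I] conjI allI impI ballI p'(1,2) I(1) inf_I)
qed

end


section \<open>Countable supports\<close>

lemma Cohen_mono: "S \<subseteq> K \<Longrightarrow> Cohen S \<subseteq> Cohen K"
  unfolding Cohen_def by blast

lemma Cohen_iff_support: "p \<in> Cohen K \<longleftrightarrow> finite (dom p) \<and> fst ` dom p \<subseteq> K"
proof -
  have "dom p \<subseteq> K \<times> UNIV \<longleftrightarrow> fst ` dom p \<subseteq> K"
    unfolding image_subset_iff subset_iff mem_Times_iff by blast
  then show ?thesis by (simp add: Cohen_def)
qed

lemma extends_refl [simp]: "extends p p"
  by (simp add: extends_def)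

lemma extends_trans: "extends r q \<Longrightarrow> extends q p \<Longrightarrow> extends r p"
  unfolding extends_def by (rule map_le_trans)

lemma countable_Cohen:
  fixes S :: "'k set"
  assumes "countable S"
  shows "countable (Cohen S)"
proof -
  define graph :: "('k \<times> nat \<rightharpoonup> bool) \<Rightarrow> (('k \<times> nat) \<times> bool) set"
    where "graph p = (\<lambda>x. (x, the (p x))) ` dom p" for p
  have graph_iff: "(x, y) \<in> graph p \<longleftrightarrow> p x = Some y" for x y p
    by (auto simp: graph_def)
  have "inj_on graph (Cohen S)"
  proof (rule inj_onI, rule ext)
    fix p q x assume "graph p = graph q"
    then have "p x = Some y \<longleftrightarrow> q x = Some y" for y using graph_iff by metis
    then show "p x = q x" by (metis option.exhaust)
  qed
  moreover have "graph ` Cohen S \<subseteq> {F. finite F \<and> F \<subseteq> (S \<times> UNIV) \<times> UNIV}"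
    by (auto simp: graph_def Cohen_def)
  moreover have "countable {F. finite F \<and> F \<subseteq> (S \<times> (UNIV :: nat set)) \<times> (UNIV :: bool set)}"
    using assms by (intro countable_Collect_finite_subset) simp
  ultimately show ?thesis
    by (meson countable_image_inj_on countable_subset)
qed

text \<open>
  Since \<open>t\<close> lives on \<open>S\<close>, it can disagree with \<open>u\<close> only there, where it extends \<open>u\<close>.
\<close>
lemma common_extension:
  assumes "t \<in> Cohen S" "S \<subseteq> K" "u \<in> Cohen K" "extends t (u |` (S \<times> UNIV))"
  shows "\<exists>v\<in>Cohen K. extends v t \<and> extends v u"
proof (rule bexI[of _ "u ++ t"])
  show "u ++ t \<in> Cohen K"
    using assms(1-3) unfolding Cohen_def by auto
  have "(u ++ t) x = u x" if "x \<in> dom u" for x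
  proof (cases "x \<in> dom t")
    case True
    then have "x \<in> S \<times> UNIV" using assms(1) unfolding Cohen_def by blast
    then have "t x = u x"
      using assms(4) that unfolding extends_def map_le_def by (auto simp: restrict_map_def dom_def)
    then show ?thesis using that by (auto simp: map_add_def split: option.split)
  next
    case False
    then show ?thesis by (simp add: map_add_dom_app_simps)
  qed
  then show "extends (u ++ t) t \<and> extends (u ++ t) u"
    unfolding extends_def by (simp add: map_le_def map_add_dom_app_simps(1))
qed

lemma restrict_in_Cohen: "u \<in> Cohen K \<Longrightarrow> u |` (S \<times> UNIV) \<in> Cohen S"
  unfolding Cohen_def by auto

text \<open>
  Starting from one coordinate, add the supports of all values of \<open>g\<close> on conditions over the set
  reached so far. A countable set carries only countably many finite conditions, so each step stays
  countable. A condition over the union of the \<open>\<omega>\<close> steps has finite support and hence lives on one step.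
\<close>
lemma Cohen_closed_support:
  fixes g :: "'i::countable \<Rightarrow> ('k \<times> nat \<rightharpoonup> bool) \<Rightarrow> ('k \<times> nat \<rightharpoonup> bool)"
  assumes "K \<noteq> {}" and g: "\<And>i q. q \<in> Cohen K \<Longrightarrow> g i q \<in> Cohen K"
  obtains S where "S \<subseteq> K" "S \<noteq> {}" "countable S" "\<And>i q. q \<in> Cohen S \<Longrightarrow> g i q \<in> Cohen S"
proof -
  obtain k where k: "k \<in> K" using assms(1) by blast
  define T where "T = rec_nat {k} (\<lambda>_ X. X \<union> (\<Union>i. \<Union>q\<in>Cohen X. fst ` dom (g i q)))"
  have T_0: "T 0 = {k}" and
    T_Suc: "T (Suc j) = T j \<union> (\<Union>i. \<Union>q\<in>Cohen (T j). fst ` dom (g i q))" for j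
    by (simp_all add: T_def)
  have T_sub: "T j \<subseteq> K" for j
  proof (induction j)
    case 0
    then show ?case using k by (simp add: T_0)
  next
    case (Suc j)
    have "fst ` dom (g i q) \<subseteq> K" if "q \<in> Cohen (T j)" for i q
      using g[OF subsetD[OF Cohen_mono[OF Suc] that]] unfolding Cohen_iff_support by blast
    then show ?case using Suc unfolding T_Suc by blast
  qed
  have T_countable: "countable (T j)" for j
  proof (induction j)
    case 0
    then show ?case by (simp add: T_0)
  next
    case (Suc j)
    have "countable (fst ` dom (g i q))" if "q \<in> Cohen (T j)" for i q
      using g[of q i] that Cohen_mono[OF T_sub] unfolding Cohen_def
      by (intro countable_image countable_finite) blast
    then show ?case
      unfolding T_Suc using Suc countable_Cohen[OF Suc]
      by (intro countable_Un countable_UN countableI_type) auto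
  qed
  have T_mono: "T i \<subseteq> T j" if "i \<le> j" for i j
    using lift_Suc_mono_le[of T i j] that by (auto simp: T_Suc)
  define S where "S = (\<Union>j. T j)"
  have closed: "g i q \<in> Cohen S" if q: "q \<in> Cohen S" for i q
  proof -
    have fin: "finite (fst ` dom q)" and "fst ` dom q \<subseteq> S"
      using q unfolding Cohen_def by auto
    then have "\<forall>x\<in>fst ` dom q. \<exists>j. x \<in> T j" unfolding S_def by blast
    from bchoice[OF this] obtain h where h: "\<forall>x\<in>fst ` dom q. x \<in> T (h x)" by blast
    obtain m where m: "\<forall>j\<in>h ` fst ` dom q. j \<le> m"
      using finite_imageI[OF fin, of h] unfolding finite_nat_set_iff_bounded_le by blast
    have "fst ` dom q \<subseteq> T m"
    proof
      fix x assume x: "x \<in> fst ` dom q"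
      then have "h x \<le> m" using m by (intro bspec[OF m] imageI)
      then show "x \<in> T m" using bspec[OF h x] T_mono by blast
    qed
    then have "q \<in> Cohen (T m)" using q by (simp add: Cohen_iff_support)
    then have "fst ` dom (g i q) \<subseteq> T (Suc m)" by (auto simp: T_Suc)
    moreover have "T (Suc m) \<subseteq> S" by (auto simp: S_def)
    moreover have "finite (dom (g i q))"
      using g[of q i] \<open>q \<in> Cohen (T m)\<close> Cohen_mono[OF T_sub] unfolding Cohen_def by blast
    ultimately show ?thesis by (simp add: Cohen_iff_support)
  qed
  show ?thesis
  proof (rule that[of S])
    show "S \<subseteq> K" "countable S" using T_sub T_countable by (auto simp: S_def)
    show "S \<noteq> {}" using T_0 by (auto simp: S_def)
  qed (rule closed)
qed

text \<open>
  Restricting conditions to the coordinates in the range of \<open>e\<close> is a projection, since an extension of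
  the restricted part can be glued to the remaining part of the condition.
\<close>
lemma forcing_projection_Cohen:
  fixes e :: "'l \<times> nat \<Rightarrow> 'k \<times> nat"
  assumes e: "inj e" "range e \<subseteq> K \<times> UNIV"
  shows "forcing_projection (Cohen K) extends Map.empty (Cohen UNIV) extends Map.empty (\<lambda>p. p \<circ> e)"
proof -
  have proj_in: "p \<circ> e \<in> Cohen UNIV" if "p \<in> Cohen K" for p
  proof -
    have "dom (p \<circ> e) = e -` dom p" by auto
    then show ?thesis using that finite_vimageI[OF _ e(1)] unfolding Cohen_def by simp
  qed
  have lift: "\<exists>p'\<in>Cohen K. extends p' p \<and> p' \<circ> e = q"
    if p: "p \<in> Cohen K" and q: "q \<in> Cohen UNIV" "extends q (p \<circ> e)" for p q
  proof -
    define p' where "p' = (\<lambda>y. if y \<in> range e then q (inv e y) else p y)"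
    have p'_e: "p' \<circ> e = q" using e(1) by (auto simp: p'_def)
    have "dom p' \<subseteq> e ` dom q \<union> dom p"
    proof
      fix y assume y: "y \<in> dom p'"
      show "y \<in> e ` dom q \<union> dom p"
      proof (cases "y \<in> range e")
        case True
        then obtain x where x: "y = e x" by blast
        then have "p' y = q x" using p'_e by auto
        then show ?thesis using x y by (auto simp: dom_def)
      next
        case False
        then show ?thesis using y by (auto simp: p'_def)
      qed
    qed
    moreover have "finite (e ` dom q \<union> dom p)" "e ` dom q \<union> dom p \<subseteq> K \<times> UNIV"
      using p q(1) e(2) unfolding Cohen_def by auto
    ultimately have "p' \<in> Cohen K"
      unfolding Cohen_def using finite_subset by blast
    moreover have "p y = p' y" if "y \<in> dom p" for y
    proof (cases "y \<in> range e")
      case True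
      then obtain x where x: "y = e x" by blast
      then have "x \<in> dom (p \<circ> e)" using that by (auto simp: dom_def)
      then have "(p \<circ> e) x = q x"
        using q(2) unfolding extends_def map_le_def by blast
      then show ?thesis using x p'_e by (metis comp_apply)
    qed (simp add: p'_def)
    then have "extends p' p" by (simp add: extends_def map_le_def)
    ultimately show ?thesis using p'_e by blast
  qed
  have "Cohen UNIV \<subseteq> (\<lambda>p. p \<circ> e) ` Cohen K"
  proof
    fix q :: "'l \<times> nat \<rightharpoonup> bool" assume q: "q \<in> Cohen UNIV"
    have "Map.empty \<in> Cohen K" by (simp add: Cohen_def)
    moreover have "extends q (Map.empty \<circ> e)" by (simp add: extends_def map_le_def dom_def)
    ultimately have "\<exists>p'\<in>Cohen K. extends p' Map.empty \<and> p' \<circ> e = q" using lift q by blast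
    then show "q \<in> (\<lambda>p. p \<circ> e) ` Cohen K" by blast
  qed
  then have onto: "(\<lambda>p. p \<circ> e) ` Cohen K = Cohen UNIV" using proj_in by blast
  show ?thesis
  proof (intro forcing_projection.intro forcing_projection_axioms.intro forcing_notion_Cohen onto lift)
    show "extends (p' \<circ> e) (p \<circ> e)" if "extends p' p" for p p' :: "'k \<times> nat \<rightharpoonup> bool"
      unfolding extends_def map_le_def
    proof
      fix x assume "x \<in> dom (p \<circ> e)"
      then have "e x \<in> dom p" by auto
      then show "(p \<circ> e) x = (p' \<circ> e) x"
        using that by (auto simp: extends_def map_le_def)
    qed
  qed
qed

locale Cohen_forcing =
  fixes K :: "'k set"

sublocale Cohen_forcing \<subseteq> forcing_notion "Cohen K" extends Map.empty
  by (rule forcing_notion_Cohen)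

context Cohen_forcing
begin

text \<open>
  If \<open>p'\<close> did not force \<open>\<phi>\<close>, some extension \<open>u\<close> of \<open>p'\<close> would force its negation. A condition
  \<open>t\<close> over \<open>S\<close> that extends the part of \<open>u\<close> on \<open>S\<close> and decides \<open>\<phi>\<close> is compatible with \<open>u\<close>
  and, as \<open>p\<close> and \<open>p'\<close> agree on \<open>S\<close>, also with \<open>p\<close>; so it can force neither \<open>\<phi>\<close> nor its negation.
\<close>
lemma agree_on_deciding_support:
  assumes S: "S \<subseteq> K"
    and reg: "regular \<phi>"
    and decided: "\<And>q. q \<in> Cohen S \<Longrightarrow> \<exists>r\<in>Cohen S. extends r q \<and> (\<phi> r \<or> Neg \<phi> r)"
    and p: "p \<in> Cohen K" "p' \<in> Cohen K" "p |` (S \<times> UNIV) = p' |` (S \<times> UNIV)" "\<phi> p"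
  shows "\<phi> p'"
proof (rule ccontr)
  assume "\<not> \<phi> p'"
  then obtain u where u: "u \<in> Cohen K" "extends u p'" "Neg \<phi> u"
    using ex_Neg_if_not[OF reg p(2)] by blast
  obtain t where t: "t \<in> Cohen S" "extends t (u |` (S \<times> UNIV))" "\<phi> t \<or> Neg \<phi> t"
    using decided[OF restrict_in_Cohen[OF u(1)]] by blast
  have tK: "t \<in> Cohen K" using t(1) Cohen_mono[OF S] by blast
  from t(3) show False
  proof
    assume "\<phi> t"
    obtain v where v: "v \<in> Cohen K" "extends v t" "extends v u"
      using common_extension[OF t(1) S u(1) t(2)] by blast
    then have "\<phi> v" using regular_mono[OF reg tK v(1,2) \<open>\<phi> t\<close>] by blast
    then show False using u(3) v by (simp add: Neg_iff)
  next
    assume neg: "Neg \<phi> t"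
    have "extends (u |` (S \<times> UNIV)) (p' |` (S \<times> UNIV))"
      using u(2) unfolding extends_def map_le_def restrict_map_def by (auto simp: dom_def)
    then have "extends t (p |` (S \<times> UNIV))" using extends_trans[OF t(2)] p(3) by simp
    then obtain v where v: "v \<in> Cohen K" "extends v t" "extends v p"
      using common_extension[OF t(1) S p(1)] by blast
    then have "\<phi> v" using regular_mono[OF reg p(1) v(1,3) p(4)] by blast
    then show False using neg v by (simp add: Neg_iff)
  qed
qed

text \<open>
  Let \<open>h\<close> choose, for each index and each condition, an extension deciding the sentence, and let \<open>S\<close>
  be a countable set closed under \<open>h\<close>. The set \<open>S \<times> \<omega>\<close> is countably infinite, like \<open>{()} \<times> \<omega>\<close>;
  hence restriction to \<open>S\<close> becomes a projection onto the forcing for one Cohen real.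
\<close>
lemma ex_deciding_projection:
  fixes \<phi> :: "'i::countable \<Rightarrow> ('k \<times> nat \<rightharpoonup> bool) \<Rightarrow> bool"
  assumes K: "K \<noteq> {}" and reg: "\<And>i. regular (\<phi> i)"
  obtains \<pi> :: "('k \<times> nat \<rightharpoonup> bool) \<Rightarrow> (unit \<times> nat \<rightharpoonup> bool)" where
    "forcing_projection (Cohen K) extends Map.empty (Cohen {()}) extends Map.empty \<pi>"
    "\<And>i p p'. p \<in> Cohen K \<Longrightarrow> p' \<in> Cohen K \<Longrightarrow> \<pi> p = \<pi> p' \<Longrightarrow> \<phi> i p \<Longrightarrow> \<phi> i p'"
proof -
  have "\<forall>(i, q)\<in>UNIV \<times> Cohen K. \<exists>r. r \<in> Cohen K \<and> extends r q \<and> (\<phi> i r \<or> Neg (\<phi> i) r)"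
    unfolding Neg_iff using extends_refl by blast
  from bchoice[OF this[unfolded split_def]] obtain h where h: "\<And>i q. q \<in> Cohen K \<Longrightarrow>
      h (i, q) \<in> Cohen K \<and> extends (h (i, q)) q \<and> (\<phi> i (h (i, q)) \<or> Neg (\<phi> i) (h (i, q)))"
    by (auto simp: mem_Times_iff)
  obtain S where S: "S \<subseteq> K" "S \<noteq> {}" "countable S"
    and closed: "\<And>i q. q \<in> Cohen S \<Longrightarrow> h (i, q) \<in> Cohen S"
    using Cohen_closed_support[OF K, of "\<lambda>i q. h (i, q)"] h by blast
  have "infinite (S \<times> (UNIV :: nat set))"
    using S(2) by (simp add: finite_cartesian_product_iff)
  then have bij: "bij_betw (from_nat_into (S \<times> (UNIV :: nat set))) UNIV (S \<times> UNIV)"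
    using S(3) by (intro bij_betw_from_nat_into) auto
  define e where "e = (\<lambda>x :: unit \<times> nat. from_nat_into (S \<times> (UNIV :: nat set)) (snd x))"
  have "inj e"
    unfolding e_def using bij
    by (auto simp: inj_on_def bij_betw_def)
  have range_e: "range e = S \<times> UNIV"
  proof -
    have "range e = from_nat_into (S \<times> (UNIV :: nat set)) ` range (snd :: unit \<times> nat \<Rightarrow> nat)"
      by (simp only: e_def image_image)
    then show ?thesis using bij by (simp add: bij_betw_def)
  qed
  show ?thesis
  proof (rule that[of "\<lambda>p. p \<circ> e"])
    show "forcing_projection (Cohen K) extends Map.empty (Cohen {()}) extends Map.empty (\<lambda>p. p \<circ> e)"
    proof -
      have "range e \<subseteq> K \<times> UNIV" unfolding range_e using S(1) by blast
      from forcing_projection_Cohen[OF \<open>inj e\<close> this] show ?thesis by (simp add: UNIV_unit)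
    qed
    fix i p p'
    assume p: "p \<in> Cohen K" "p' \<in> Cohen K" and eq: "p \<circ> e = p' \<circ> e" and "\<phi> i p"
    have "p y = p' y" if y: "y \<in> S \<times> UNIV" for y
    proof -
      obtain x where "y = e x" using y unfolding range_e[symmetric] by blast
      then show ?thesis using fun_cong[OF eq, of x] by simp
    qed
    then have "p |` (S \<times> UNIV) = p' |` (S \<times> UNIV)" by (simp add: restrict_map_def fun_eq_iff)
    moreover have "\<exists>r\<in>Cohen S. extends r q \<and> (\<phi> i r \<or> Neg (\<phi> i) r)" if "q \<in> Cohen S" for q
      using h[of q i] closed[OF that, of i] that Cohen_mono[OF S(1)] by blast
    ultimately show "\<phi> i p'"
      using agree_on_deciding_support[OF S(1) reg _ p] \<open>\<phi> i p\<close> by blast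
  qed
qed

end

section \<open>From one Cohen real to many\<close>

theorem proposition33:
  fixes A :: "nat set set" and K :: "'k set"
  assumes "almost_disjoint_family A"
    and "remains_MAD_and_fin_intersecting_after_Cohen {()} A"
    and "K \<noteq> {}"
  shows "remains_MAD_and_fin_intersecting_after_Cohen K A"
proof -
  interpret Q: Cohen_forcing "{()}" .
  interpret P: Cohen_forcing K .
  have Q: "Q.every_real_meets A" "Q.centers_fin_sequences A"
    using assms(2) Q.remains_MAD_and_fin_intersecting_iff[OF assms(1)]
    unfolding remains_MAD_and_fin_intersecting_after_Cohen_def by simp_all
  have "P.every_real_meets A"
    unfolding P.every_real_meets_def
  proof (intro ballI impI)
    fix \<sigma> p assume p: "p \<in> Cohen K" "P.Infin (\<lambda>n. P.Mem n \<sigma>) p"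
    obtain \<pi> :: "('k \<times> nat \<rightharpoonup> bool) \<Rightarrow> (unit \<times> nat \<rightharpoonup> bool)" where
      \<pi>: "forcing_projection (Cohen K) extends Map.empty (Cohen {()}) extends Map.empty \<pi>"
      and inv: "\<And>n p p'. p \<in> Cohen K \<Longrightarrow> p' \<in> Cohen K \<Longrightarrow> \<pi> p = \<pi> p' \<Longrightarrow> P.Mem n \<sigma> p \<Longrightarrow> P.Mem n \<sigma> p'"
      using P.ex_deciding_projection[OF assms(3), of "\<lambda>n. P.Mem n \<sigma>"] P.regular_Mem by blast
    show "\<exists>q\<in>Cohen K. extends q p \<and>
        (\<exists>a\<in>A. P.Infin (\<lambda>n. P.Conj (P.Mem n \<sigma>) (P.Mem n (P.check a))) q)"
      by (rule forcing_projection.real_meets_if_every_real_meets_projection[OF \<pi> Q(1) _ p])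
        (fact inv)
  qed
  moreover have "P.centers_fin_sequences A"
    unfolding P.centers_fin_sequences_def
  proof (intro ballI impI)
    fix C p assume p: "p \<in> Cohen K" "P.fin_sequence C p"
    obtain \<pi> :: "('k \<times> nat \<rightharpoonup> bool) \<Rightarrow> (unit \<times> nat \<rightharpoonup> bool)" where
      \<pi>: "forcing_projection (Cohen K) extends Map.empty (Cohen {()}) extends Map.empty \<pi>"
      and inv: "\<And>i p p'. p \<in> Cohen K \<Longrightarrow> p' \<in> Cohen K \<Longrightarrow> \<pi> p = \<pi> p' \<Longrightarrow>
        P.Mem (snd i) (C (fst i)) p \<Longrightarrow> P.Mem (snd i) (C (fst i)) p'"
      using P.ex_deciding_projection[OF assms(3), of "\<lambda>i. P.Mem (snd i) (C (fst i))"]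
        P.regular_Mem by blast
    have inv': "P.Mem k (C n) p'"
      if "p \<in> Cohen K" "p' \<in> Cohen K" "\<pi> p = \<pi> p'" "P.Mem k (C n) p" for n k p p'
      using inv[of p p' "(n, k)"] that by simp
    show "\<exists>q\<in>Cohen K. extends q p \<and> (\<exists>I\<in>P.real_names. P.Infin (\<lambda>n. P.Mem n I) q \<and>
          (\<forall>F. finite F \<longrightarrow> F \<noteq> {} \<longrightarrow> F \<subseteq> A \<longrightarrow>
            (\<forall>r\<in>Cohen K. extends r q \<longrightarrow> (\<forall>a\<in>F. P.Infin (P.trace C I (P.check a)) r) \<longrightarrow>
              P.Infin (\<lambda>n. P.Forall F (\<lambda>a. P.trace C I (P.check a) n)) r)))"
      by (rule forcing_projection.fin_sequence_centered_if_centers_projection[OF \<pi> Q(2) _ p])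
        (fact inv')
  qed
  ultimately show ?thesis
    using P.remains_MAD_and_fin_intersecting_iff[OF assms(1)]
    unfolding remains_MAD_and_fin_intersecting_after_Cohen_def by simp
qed

end
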